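(* There is an absolute constant $c$ (independent of $d$) such that for every $d$, every $n\ge 2d$, and every set $H$ of $n$ hyperplanes in $\mathbb{R}^d$ (in generic coordinate position), the number of prisms of all dimensions in the vertical decomposition $\mathrm{VD}(H)$ of $\mathcal{A}(H)$ is at most $c\,\frac{4^d}{d^{7/2}}\,n^{2d}$.
   Context: Vertical decomposition $\mathrm{VD}$ of a convex polyhedron $C\subseteq\mathbb{R}^d$ is defined recursively on $d$. First stage: for a facet $f^+$ of the upper boundary and a facet $f^-$ of the lower boundary of $C$ (with respect to $x_d$), whose vertical projections onto $x_d=0$ overlap in a $(d-1)$-dimensional set $P$, form the prism $\{p\in C:\text{projection of }p\in P\}$. Unbounded cells may give prisms with only a floor or only a ceiling. Recursion: vertically decompose $P\subseteq\mathbb{R}^{d-1}$ recursively and lift the resulting prisms back. Base case: in dimension 1 an interval is its own decomposition. $\mathrm{VD}(H)$ is the union of the decompositions of all cells, of every dimension, of $\mathcal{A}(H)$. A $j$-dimensional cell is decomposed within its supporting $j$-flat with generic coordinates. Generic position means no intersection flat is parallel to a coordinate axis. *)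

theory Defs
  imports "HOL-Analysis.Analysis" "HOL-Library.Function_Algebras"
begin

text \<open>Since the dimension d is quantified inside the statement, points of R^k are
represented as functions nat => real vanishing from index k on. Coordinate x_(i+1)
of the paper is index i; the vertical coordinate x_k of R^k is index k-1.
We equip functions with the pointwise real vector space structure; the product
topology (Function_Topology) restricts to the Euclidean topology on each R^k.\<close>

instantiation "fun" :: (type, real_vector) real_vector
begin
definition scaleR_fun :: "real \<Rightarrow> ('a \<Rightarrow> 'b) \<Rightarrow> 'a \<Rightarrow> 'b"
  where "scaleR_fun r f = (\<lambda>x. r *\<^sub>R f x)"
instance
  by standard (auto simp: scaleR_fun_def fun_eq_iff plus_fun_def scaleR_add_right scaleR_add_left)
end

type_synonym vec = "nat \<Rightarrow> real"

definition rspace :: "nat \<Rightarrow> vec set" where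
  "rspace k = {x. \<forall>i\<ge>k. x i = 0}"

definition unitv :: "nat \<Rightarrow> vec" where
  "unitv i = (\<lambda>j. if j = i then 1 else 0)"

definition vproj :: "nat \<Rightarrow> vec \<Rightarrow> vec" where
  "vproj k x = (\<lambda>i. if i < k then x i else 0)"

definition adim :: "vec set \<Rightarrow> nat" where
  "adim S = dim {x - y | x y. x \<in> S \<and> y \<in> S}"

definition is_facet :: "vec set \<Rightarrow> vec set \<Rightarrow> bool" where
  "is_facet F S \<longleftrightarrow> F face_of S \<and> F \<noteq> {} \<and> adim F + 1 = adim S"

text \<open>For S in R^(k+1), vertical direction = unitv k.\<close>
definition upper_facet :: "nat \<Rightarrow> vec set \<Rightarrow> vec set \<Rightarrow> bool" where
  "upper_facet k S F \<longleftrightarrow> is_facet F S \<and> (\<forall>p\<in>F. \<forall>t>0. p + t *\<^sub>R unitv k \<notin> S)"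

definition lower_facet :: "nat \<Rightarrow> vec set \<Rightarrow> vec set \<Rightarrow> bool" where
  "lower_facet k S F \<longleftrightarrow> is_facet F S \<and> (\<forall>p\<in>F. \<forall>t>0. p - t *\<^sub>R unitv k \<notin> S)"

text \<open>Base (in R^k) of the prism with ceiling f (None = no ceiling) and floor g
(None = no floor).\<close>
definition vd_base :: "nat \<Rightarrow> vec set \<Rightarrow> vec set option \<times> vec set option \<Rightarrow> vec set" where
  "vd_base k S p = (case p of
      (Some F, Some G) \<Rightarrow> vproj k ` F \<inter> vproj k ` G
    | (Some F, None) \<Rightarrow> vproj k ` F
    | (None, Some G) \<Rightarrow> vproj k ` G
    | (None, None) \<Rightarrow> vproj k ` S)"

text \<open>The prisms of the first stage of the decomposition of a full-dimensional
closed convex polyhedron S in R^(k+1), indexed by (ceiling, floor).  A prism is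
kept only if its base is k-dimensional.  Prisms with only a ceiling (only a floor,
neither) occur when S has no lower (upper, no) facets, i.e. is unbounded in that
vertical direction.\<close>
definition vd_pairs :: "nat \<Rightarrow> vec set \<Rightarrow> (vec set option \<times> vec set option) set" where
  "vd_pairs k S =
     {p. (case p of
           (Some F, Some G) \<Rightarrow> upper_facet k S F \<and> lower_facet k S G
         | (Some F, None) \<Rightarrow> upper_facet k S F \<and> (\<nexists>G. lower_facet k S G)
         | (None, Some G) \<Rightarrow> lower_facet k S G \<and> (\<nexists>F. upper_facet k S F)
         | (None, None) \<Rightarrow> (\<nexists>F. upper_facet k S F) \<and> (\<nexists>G. lower_facet k S G))
         \<and> vd_base k S p \<noteq> {} \<and> adim (vd_base k S p) = k}"

text \<open>vd k S = number of prisms in the vertical decomposition of the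
full-dimensional closed convex polyhedron S in R^k (recursively decomposing the
bases and lifting; lifting preserves the number of prisms).  In dimension 1 (and 0)
the set is its own decomposition.\<close>
primrec vd :: "nat \<Rightarrow> vec set \<Rightarrow> nat" where
  "vd 0 = (\<lambda>S. 1)"
| "vd (Suc k) = (\<lambda>S. if k = 0 then 1
                    else (\<Sum>p\<in>vd_pairs k S. vd k (vd_base k S p)))"

definition hyperplane_in :: "nat \<Rightarrow> vec set \<Rightarrow> bool" where
  "hyperplane_in d h \<longleftrightarrow> (\<exists>a b. (\<exists>i<d. a i \<noteq> 0) \<and>
      h = {x \<in> rspace d. (\<Sum>i<d. a i * x i) = b})"

text \<open>Cells (of every dimension) of the arrangement A(H): the classes of points of
R^d lying on the same side of / on each hyperplane of H (relatively open).\<close>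
definition arr_cells :: "nat \<Rightarrow> vec set set \<Rightarrow> vec set set" where
  "arr_cells d H = {{y \<in> rspace d. \<forall>h\<in>H. (y \<in> h \<longleftrightarrow> x \<in> h) \<and>
                        (x \<notin> h \<longrightarrow> closed_segment x y \<inter> h = {})} | x. x \<in> rspace d}"

definition int_flats :: "vec set set \<Rightarrow> vec set set" where
  "int_flats H = {\<Inter>G | G. G \<subseteq> H \<and> G \<noteq> {} \<and> \<Inter>G \<noteq> {}}"

definition parallel_to_axis :: "nat \<Rightarrow> vec set \<Rightarrow> bool" where
  "parallel_to_axis k F \<longleftrightarrow> (\<exists>i<k. \<exists>x\<in>F. \<forall>t::real. x + t *\<^sub>R unitv i \<in> F)"

definition generic_arrangement :: "nat \<Rightarrow> vec set set \<Rightarrow> bool" where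
  "generic_arrangement d H \<longleftrightarrow> (\<forall>F\<in>int_flats H. \<not> parallel_to_axis d F)"

definition generic_frame :: "nat \<Rightarrow> vec set set \<Rightarrow> vec set \<Rightarrow> (vec \<Rightarrow> vec) \<Rightarrow> bool" where
  "generic_frame j H F \<phi> \<longleftrightarrow>
     (\<exists>L c. linear L \<and> \<phi> = (\<lambda>y. c + L y)) \<and> bij_betw \<phi> (rspace j) F \<and>
     (\<forall>G\<in>int_flats H. G \<subset> F \<longrightarrow> \<not> parallel_to_axis j {y \<in> rspace j. \<phi> y \<in> G})"

text \<open>Number of prisms of all dimensions in VD(H): each j-cell C is decomposed
within its supporting j-flat (affine hull), in the coordinates given by the frame
fr of that flat; d-dimensional cells use the standard coordinates of R^d.\<close>
definition cell_coords :: "nat \<Rightarrow> (vec set \<Rightarrow> vec \<Rightarrow> vec) \<Rightarrow> vec set \<Rightarrow> vec set" where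
  "cell_coords d fr C = (if adim C = d then closure C
      else {y \<in> rspace (adim C). fr (affine hull C) y \<in> closure C})"

definition VD_size :: "nat \<Rightarrow> vec set set \<Rightarrow> (vec set \<Rightarrow> vec \<Rightarrow> vec) \<Rightarrow> nat" where
  "VD_size d H fr = (\<Sum>C\<in>arr_cells d H. vd (adim C) (cell_coords d fr C))"

end

theory Submission
  imports Defs
begin

text \<open>A polyhedron is given by a set of affine constraints, some bounding the vertical coordinate from
  above, some from below. Passing to the base of a first-stage prism with ceiling a and floor b
  substitutes a into the constraints bounding from above and b into the others, the remaining
  combinations being implied: each constraint stays a single constraint, so the set of labels never
  grows.

  All polyhedra of an arrangement of n hyperplanes in a flat can therefore be decomposed simultaneously.
  They use 2n labels (a hyperplane and a side) and have pairwise disjoint interiors; each choice of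
  ceiling and floor, possibly absent, yields another family with these two properties, one dimension
  lower. If u labels bound from above and w from below, then \<open>u + w \<le> 2n\<close>, so there are at most
  \<open>(u + 1) (w + 1) \<le> (n + 1)\<^sup>2\<close> choices, hence at most \<open>(n + 1)\<^sup>2\<^sup>j\<close> prisms in a j-flat. Every j-flat spanned by a cell is cut
  out by at most d - j of the hyperplanes; summing over all flats gives a total of at most
  \<open>(d + 1)\<^sup>2 (n + 1)\<^sup>2\<^sup>d\<close>, where \<open>(1 + 1 / n)\<^sup>2\<^sup>d\<close> is bounded because 2d does not exceed n. Thus the factor
  \<open>4\<^sup>d\<close> leaves room to spare for the powers of d.\<close>

section \<open>Affine functionals and algebraic interiors\<close>

text \<open>What bounds the count is not the complexity of one polyhedron but that the members of a
  family compete for the same space. A label (ceiling, floor) fixes the substitution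
  \<open>upd\<close> without reference to the polyhedron, so the bases of all prisms with that label
  are described by the same new functionals. If two of these bases had a common interior point z,
  the two polyhedra would have a common interior point above z: just behind the facet if only a
  ceiling or only a floor is present, strictly between them if both are, z itself if neither is.
  Disjointness thus descends to R^0, a single point, where at most one member is left. "Interior"
  must be relative to R^k, which has empty interior in the space of all functions; the algebraic
  interior \<open>core\<close> serves. For a polyhedron it means strictness of every constraint that
  is not identically zero. The exception matters: elimination produces zero functionals, and a cell
  inside a hyperplane carries both sides of it.\<close>

definition lin :: "nat \<Rightarrow> vec \<times> real \<Rightarrow> vec \<Rightarrow> real" where
  "lin k f v = (\<Sum>i<k. fst f i * v i)"

text \<open>The same pair is read at every k, coefficients from index k on being ignored. A
  constraint without vertical coefficient can therefore be passed unchanged from R^(k+1) to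
  R^k.\<close>

definition ev :: "nat \<Rightarrow> vec \<times> real \<Rightarrow> vec \<Rightarrow> real" where
  "ev k f x = snd f + lin k f x"

lemma lin_zero: "lin k f 0 = 0"
  by (simp add: lin_def)

lemma lin_add: "lin k f (x + y) = lin k f x + lin k f y"
  by (simp add: lin_def distrib_left sum.distrib)

lemma lin_diff: "lin k f (x - y) = lin k f x - lin k f y"
  by (simp add: lin_def right_diff_distrib sum_subtractf)

lemma lin_scaleR: "lin k f (t *\<^sub>R x) = t * lin k f x"
  by (simp add: lin_def scaleR_fun_def sum_distrib_left mult.left_commute)

lemma ev_add_scaleR: "ev k f (x + t *\<^sub>R v) = ev k f x + t * lin k f v"
  by (simp add: ev_def lin_add lin_scaleR)

lemma ev_diff_scaleR: "ev k f (x - t *\<^sub>R v) = ev k f x - t * lin k f v"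
  by (simp add: ev_def lin_diff lin_scaleR)

lemma lin_eq_ev_diff: "lin k f (x - y) = ev k f x - ev k f y"
  by (simp add: ev_def lin_diff)

lemma ev_affine: "u + v = 1 \<Longrightarrow> ev k f (u *\<^sub>R x + v *\<^sub>R y) = u * ev k f x + v * ev k f y"
proof -
  assume "u + v = 1"
  then have "snd f = u * snd f + v * snd f"
    by (metis distrib_right mult_1)
  then show ?thesis
    by (simp add: ev_def lin_add lin_scaleR distrib_left)
qed

lemma lin_vproj [simp]: "lin k f (vproj k x) = lin k f x"
  by (simp add: lin_def vproj_def)

lemma ev_vproj [simp]: "ev k f (vproj k x) = ev k f x"
  by (simp add: ev_def)

lemma lin_Suc: "lin (Suc k) f x = lin k f x + fst f k * x k"
  by (simp add: lin_def)

lemma ev_Suc: "ev (Suc k) f x = ev k f x + fst f k * x k"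
  by (simp add: ev_def lin_Suc)

lemma lin_unitv: "lin (Suc k) f (unitv k) = fst f k"
  by (simp add: lin_Suc) (simp add: lin_def unitv_def)

lemma ev_Suc_add_unitv: "ev (Suc k) f (x + t *\<^sub>R unitv k) = ev (Suc k) f x + t * fst f k"
  by (simp add: ev_add_scaleR lin_unitv)

lemma rspace_add: "x \<in> rspace k \<Longrightarrow> y \<in> rspace k \<Longrightarrow> x + y \<in> rspace k"
  by (simp add: rspace_def)

lemma rspace_diff: "x \<in> rspace k \<Longrightarrow> y \<in> rspace k \<Longrightarrow> x - y \<in> rspace k"
  by (simp add: rspace_def)

lemma rspace_scaleR: "x \<in> rspace k \<Longrightarrow> t *\<^sub>R x \<in> rspace k"
  by (simp add: rspace_def scaleR_fun_def)

lemma rspace_zero: "0 \<in> rspace k"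
  by (simp add: rspace_def)

lemma subspace_rspace: "subspace (rspace k)"
  by (simp add: subspace_def rspace_zero rspace_add rspace_scaleR)

lemma unitv_in_rspace: "i < k \<Longrightarrow> unitv i \<in> rspace k"
  by (auto simp: rspace_def unitv_def)

lemma vproj_in_rspace: "vproj k x \<in> rspace k"
  by (simp add: rspace_def vproj_def)

lemma vproj_ident: "x \<in> rspace k \<Longrightarrow> vproj k x = x"
  by (auto simp: rspace_def vproj_def fun_eq_iff)

lemma vproj_Suc_decomp: "x \<in> rspace (Suc k) \<Longrightarrow> x = vproj k x + x k *\<^sub>R unitv k"
  by (auto simp: rspace_def vproj_def unitv_def fun_eq_iff scaleR_fun_def less_Suc_eq not_less)

lemma vproj_add_scaleR: "vproj k (x + t *\<^sub>R y) = vproj k x + t *\<^sub>R vproj k y"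
  by (auto simp: vproj_def fun_eq_iff scaleR_fun_def)

lemma vproj_unitv: "vproj k (unitv k) = 0"
  by (auto simp: vproj_def unitv_def fun_eq_iff)

lemma vproj_lift: "z \<in> rspace k \<Longrightarrow> vproj k (z + t *\<^sub>R unitv k) = z"
  by (simp add: vproj_add_scaleR vproj_unitv vproj_ident)

lemma rspace_Suc_mono: "x \<in> rspace k \<Longrightarrow> x \<in> rspace (Suc k)"
  by (simp add: rspace_def)

lemma rspace_lift: "z \<in> rspace k \<Longrightarrow> z + t *\<^sub>R unitv k \<in> rspace (Suc k)"
  by (simp add: rspace_Suc_mono rspace_add rspace_scaleR unitv_in_rspace)

section \<open>Bases and dimension in R^k, inside the infinite-dimensional space of
  functions\<close>

lemma vec_eq_sum_unitv: "x \<in> rspace k \<Longrightarrow> x = (\<Sum>i<k. x i *\<^sub>R unitv i)"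
proof (induction k arbitrary: x)
  case 0
  then show ?case by (simp add: rspace_def fun_eq_iff)
next
  case (Suc k)
  have "(\<Sum>i<k. vproj k x i *\<^sub>R unitv i) = (\<Sum>i<k. x i *\<^sub>R unitv i)"
    by (intro sum.cong) (auto simp: vproj_def)
  then have "vproj k x = (\<Sum>i<k. x i *\<^sub>R unitv i)"
    by (rule trans[OF Suc.IH[OF vproj_in_rspace]])
  then have "vproj k x + x k *\<^sub>R unitv k = (\<Sum>i<Suc k. x i *\<^sub>R unitv i)"
    by simp
  then show ?case
    by (rule trans[OF vproj_Suc_decomp[OF Suc.prems]])
qed

lemma rspace_subset_span: "rspace k \<subseteq> span (unitv ` {..<k})"
proof
  fix x assume "x \<in> rspace k"
  then have "x = (\<Sum>i<k. x i *\<^sub>R unitv i)"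
    by (rule vec_eq_sum_unitv)
  also have "\<dots> \<in> span (unitv ` {..<k})"
    by (intro span_sum span_scale span_base) auto
  finally show "x \<in> span (unitv ` {..<k})" .
qed

lemma independent_in_rspace:
  assumes "independent B" "B \<subseteq> rspace k"
  shows "finite B" "card B \<le> k"
proof -
  have "finite B \<and> card B \<le> card (unitv ` {..<k})"
    using assms rspace_subset_span by (intro independent_span_bound) auto
  moreover have "card (unitv ` {..<k}) \<le> k"
    by (metis card_image_le card_lessThan finite_lessThan)
  ultimately show "finite B" "card B \<le> k" by auto
qed

lemma span_basis_rspace:
  assumes "independent B" "B \<subseteq> rspace k" "card B = k"
  shows "rspace k \<subseteq> span B"
proof (rule ccontr)
  assume "\<not> rspace k \<subseteq> span B"
  then obtain v where v: "v \<in> rspace k" "v \<notin> span B" by blast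
  have "v \<notin> B" using v span_base by blast
  moreover have "independent (insert v B)"
    using v assms independent_insertI by blast
  ultimately show False
    using independent_in_rspace[of "insert v B" k] independent_in_rspace(1)[of B k] v assms by auto
qed

lemma dim_less_rspace:
  assumes "subspace U" "subspace V" "U \<subset> V" "V \<subseteq> rspace k"
  shows "dim U < dim V"
proof -
  obtain B where B: "B \<subseteq> U" "independent B" "U \<subseteq> span B" "card B = dim U"
    using basis_exists by blast
  obtain v where v: "v \<in> V" "v \<notin> U" using assms by blast
  have "span B \<subseteq> U" using B assms by (simp add: span_minimal)
  then have ind: "independent (insert v B)" and "v \<notin> B"
    using v B independent_insertI span_base by blast+
  have "insert v B \<subseteq> V" using v B assms by blast
  then obtain B' where B': "insert v B \<subseteq> B'" "B' \<subseteq> V" "independent B'" "V \<subseteq> span B'"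
    using maximal_independent_subset_extend[OF _ ind] by blast
  have "finite B'" using independent_in_rspace B' assms by blast
  then have "card (insert v B) \<le> card B'" using B' card_mono by blast
  moreover have "finite B" using \<open>finite B'\<close> B'(1) by (auto dest: finite_subset)
  moreover have "dim V = card B'" using B' by (intro dim_unique[of B']) auto
  ultimately show ?thesis using B(4) \<open>v \<notin> B\<close> by simp
qed

text \<open>Without a finite-dimensional bound this can fail: \<open>dim\<close> is the cardinality
  of a basis, which is 0 for an infinite one. Inside \<open>rspace k\<close> bases are
  finite.\<close>

lemma dim_mono_rspace:
  assumes "U \<subseteq> V" "V \<subseteq> rspace k"
  shows "dim U \<le> dim V"
proof -
  obtain B where B: "B \<subseteq> V" "independent B" "V \<subseteq> span B" "card B = dim V"
    using basis_exists by blast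
  then show ?thesis
    using dim_le_card[of U B] independent_in_rspace[of B k] assms by (metis order_trans)
qed

lemma dim_rspace: "dim (rspace k) = k"
proof (rule antisym)
  show "dim (rspace k) \<le> k"
    using dim_le_card[OF rspace_subset_span, of k] card_image_le[of "{..<k}" unitv] by simp
  show "k \<le> dim (rspace k)"
  proof (induction k)
    case (Suc k)
    have "unitv k \<in> rspace (Suc k)" "unitv k \<notin> rspace k"
      by (auto simp: rspace_def unitv_def)
    then have "rspace k \<subset> rspace (Suc k)"
      using rspace_Suc_mono by blast
    then have "dim (rspace k) < dim (rspace (Suc k))"
      using dim_less_rspace subspace_rspace by blast
    with Suc show ?case by simp
  qed simp
qed

text \<open>The algebraic interior of S relative to R^k. One e for both signs makes the good
  directions at a point of a convex set a subspace, so that they need only be checked on a basis;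
  the direction 0 yields membership in S.\<close>

definition core :: "nat \<Rightarrow> vec set \<Rightarrow> vec set" where
  "core k S = {p \<in> rspace k. \<forall>v\<in>rspace k. \<exists>e>0. p + e *\<^sub>R v \<in> S \<and> p - e *\<^sub>R v \<in> S}"

lemma core_subset:
  assumes "p \<in> core k S"
  shows "p \<in> S"
proof -
  have "\<exists>e>0. p + e *\<^sub>R (0::vec) \<in> S"
    using assms rspace_zero by (force simp: core_def)
  then show ?thesis by simp
qed

lemma core_mono: "S \<subseteq> T \<Longrightarrow> core k S \<subseteq> core k T"
  unfolding core_def by blast

lemma sum_weights_indicator:
  fixes x :: "'a :: real_vector"
  assumes "finite Q" "x \<in> Q"
  shows "(\<Sum>q\<in>Q. (if q = x then e else 0) *\<^sub>R q) = e *\<^sub>R x"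
proof -
  have "(\<Sum>q\<in>Q. (if q = x then e else 0) *\<^sub>R q) = (\<Sum>q\<in>Q. if q = x then e *\<^sub>R q else 0)"
    by (intro sum.cong) auto
  then show ?thesis using assms by (simp add: sum.delta)
qed

text \<open>At the barycenter every point of Q has weight 1/m, so the whole weight of y can be
  handed to x without any weight becoming negative.\<close>

lemma barycenter_move:
  fixes Q :: "'a :: real_vector set"
  assumes "finite Q" "x \<in> Q" "y \<in> Q" "convex S" "Q \<subseteq> S"
  defines "m \<equiv> real (card Q)"
  shows "(\<Sum>q\<in>Q. (1/m) *\<^sub>R q) + (1/m) *\<^sub>R (x - y) \<in> S"
proof -
  define w where "w q = 1/m + (if q = x then 1/m else 0) - (if q = y then 1/m else 0)" for q
  have "Q \<noteq> {}" using assms(2) by blast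
  then have m: "m > 0" using assms(1) by (simp add: m_def card_gt_0_iff)
  have "(\<Sum>q\<in>Q. w q *\<^sub>R q) \<in> S"
  proof (rule convex_sum)
    show "(\<Sum>q\<in>Q. w q) = 1"
      using assms(1-3) m \<open>Q \<noteq> {}\<close> by (simp add: w_def sum.distrib sum_subtractf m_def)
    show "\<And>q. q \<in> Q \<Longrightarrow> 0 \<le> w q"
      using m by (auto simp: w_def)
  qed (use assms(1,4,5) in auto)
  moreover have "(\<Sum>q\<in>Q. w q *\<^sub>R q) = (\<Sum>q\<in>Q. (1/m) *\<^sub>R q)
      + (\<Sum>q\<in>Q. (if q = x then 1/m else 0) *\<^sub>R q) - (\<Sum>q\<in>Q. (if q = y then 1/m else 0) *\<^sub>R q)"
    unfolding w_def by (simp only: scaleR_left_distrib scaleR_left_diff_distrib sum.distrib sum_subtractf)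
  ultimately show ?thesis
    by (simp only: sum_weights_indicator[OF assms(1,2)] sum_weights_indicator[OF assms(1,3)]
        scaleR_right_diff_distrib add_diff_eq)
qed

lemma convex_move_le:
  fixes p v :: "'a :: real_vector"
  assumes "convex S" "p \<in> S" "p + e *\<^sub>R v \<in> S" "0 \<le> t" "t \<le> e"
  shows "p + t *\<^sub>R v \<in> S"
proof (cases "e = 0")
  case False
  have "(1 - t/e) *\<^sub>R p + (t/e) *\<^sub>R (p + e *\<^sub>R v) \<in> S"
    using assms False by (intro convexD) auto
  moreover have "(1 - t/e) *\<^sub>R p + (t/e) *\<^sub>R (p + e *\<^sub>R v) = p + t *\<^sub>R v"
    using False by (simp add: algebra_simps)
  ultimately show ?thesis by simp
qed (use assms in auto)

lemma convex_move_le_diff: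
  fixes p v :: "'a :: real_vector"
  assumes "convex S" "p \<in> S" "p - e *\<^sub>R v \<in> S" "0 \<le> t" "t \<le> e"
  shows "p - t *\<^sub>R v \<in> S"
  using convex_move_le[of S p e "- v" t] assms by simp

text \<open>Closure under addition: the midpoint of two moves of a common length g along v and w is
  a move of length g/2 along v + w.\<close>

lemma subspace_two_sided_directions:
  fixes p :: "'a :: real_vector"
  assumes "convex S" "p \<in> S"
  shows "subspace {v. \<exists>e>0. p + e *\<^sub>R v \<in> S \<and> p - e *\<^sub>R v \<in> S}" (is "subspace ?D")
proof (rule subspaceI)
  show "0 \<in> ?D" using assms by (auto intro: exI[of _ 1])
next
  fix v w assume "v \<in> ?D" "w \<in> ?D"
  then obtain e f where e: "e > 0" "p + e *\<^sub>R v \<in> S" "p - e *\<^sub>R v \<in> S"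
    and f: "f > 0" "p + f *\<^sub>R w \<in> S" "p - f *\<^sub>R w \<in> S" by blast
  define g where "g = min e f"
  have g: "0 < g" "g \<le> e" "g \<le> f" using e f by (auto simp: g_def)
  have "(1/2) *\<^sub>R (p + g *\<^sub>R v) + (1/2) *\<^sub>R (p + g *\<^sub>R w) \<in> S"
    using convex_move_le[of S p e v g] convex_move_le[of S p f w g] assms e f g
    by (intro convexD) auto
  moreover have "(1/2) *\<^sub>R (p - g *\<^sub>R v) + (1/2) *\<^sub>R (p - g *\<^sub>R w) \<in> S"
    using convex_move_le_diff[of S p e v g] convex_move_le_diff[of S p f w g] assms e f g
    by (intro convexD) auto
  moreover have "(1/2) *\<^sub>R p + (1/2) *\<^sub>R p = p"
    unfolding scaleR_left_distrib[symmetric] by simp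
  then have "(1/2) *\<^sub>R (p + g *\<^sub>R v) + (1/2) *\<^sub>R (p + g *\<^sub>R w) = p + (g/2) *\<^sub>R (v + w)" for v w
    by (simp add: scaleR_right_distrib add.assoc add.left_commute)
  note this[of v w] this[of "- v" "- w"]
  moreover have "p - (g/2) *\<^sub>R (v + w) = p + (g/2) *\<^sub>R (- v + - w)"
    by (simp add: scaleR_right_distrib scaleR_right_diff_distrib)
  ultimately show "v + w \<in> ?D" using g(1)
    by (intro CollectI exI[of _ "g/2"]) (simp only: scaleR_minus_right add_uminus_conv_diff, simp)
next
  fix c v assume "v \<in> ?D"
  then obtain e where e: "e > 0" "p + e *\<^sub>R v \<in> S" "p - e *\<^sub>R v \<in> S" by blast
  show "c *\<^sub>R v \<in> ?D"
  proof (cases "c = 0")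
    case True
    then show ?thesis using assms by (auto intro: exI[of _ 1])
  next
    case False
    have "p + (e / \<bar>c\<bar>) *\<^sub>R (c *\<^sub>R v) \<in> S \<and> p - (e / \<bar>c\<bar>) *\<^sub>R (c *\<^sub>R v) \<in> S"
      using e(2,3) False by (cases "c > 0") simp_all
    then show ?thesis using e(1) False
      by (intro CollectI exI[of _ "e / \<bar>c\<bar>"]) simp
  qed
qed

text \<open>Finitely many points of S have differences that span R^k; their barycenter can be moved
  both ways along each of these differences.\<close>

lemma core_nonempty_of_adim:
  assumes "convex S" "S \<subseteq> rspace k" "S \<noteq> {}" "adim S = k"
  shows "core k S \<noteq> {}"
proof -
  let ?D = "{x - y | x y. x \<in> S \<and> y \<in> S}"
  obtain B where B: "B \<subseteq> ?D" "independent B" "card B = dim ?D"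
    by (rule basis_exists[of ?D])
  then have B: "B \<subseteq> ?D" "independent B" "card B = k"
    using assms(4) by (simp_all add: adim_def)
  have "?D \<subseteq> rspace k" using assms rspace_diff by blast
  then have Br: "B \<subseteq> rspace k" using B by blast
  then have "finite B" using B independent_in_rspace by blast
  have "\<forall>b\<in>B. \<exists>x y. x \<in> S \<and> y \<in> S \<and> b = x - y"
    using B(1) by blast
  then obtain xs ys where xy: "\<And>b. b \<in> B \<Longrightarrow> xs b \<in> S \<and> ys b \<in> S \<and> b = xs b - ys b"
    by metis
  obtain p0 where "p0 \<in> S" using assms by blast
  \<comment> \<open>\<open>p0\<close> keeps Q nonempty when k = 0, where B is empty.\<close>
  define Q where "Q = insert p0 (xs ` B \<union> ys ` B)"
  have Q: "finite Q" "Q \<noteq> {}" "Q \<subseteq> S"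
    using \<open>finite B\<close> xy \<open>p0 \<in> S\<close> by (auto simp: Q_def)
  define m where "m = real (card Q)"
  have m: "m > 0" using Q by (auto simp: m_def card_gt_0_iff)
  define p where "p = (\<Sum>q\<in>Q. (1/m) *\<^sub>R q)"
  have "p \<in> S"
    unfolding p_def using Q m assms by (intro convex_sum) (auto simp: m_def)
  define U where "U = {v. \<exists>e>0. p + e *\<^sub>R v \<in> S \<and> p - e *\<^sub>R v \<in> S}"
  have "subspace U"
    unfolding U_def using assms \<open>p \<in> S\<close> by (intro subspace_two_sided_directions)
  have "B \<subseteq> U"
  proof
    fix b assume b: "b \<in> B"
    then have "xs b \<in> Q" "ys b \<in> Q" by (auto simp: Q_def)
    then have in_S: "p + (1/m) *\<^sub>R (xs b - ys b) \<in> S" "p + (1/m) *\<^sub>R (ys b - xs b) \<in> S"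
      using barycenter_move[OF Q(1) _ _ assms(1) Q(3)] by (simp_all add: p_def m_def)
    have "b = xs b - ys b" using xy[OF b] by simp
    then have "(1/m) *\<^sub>R (xs b - ys b) = (1/m) *\<^sub>R b" "(1/m) *\<^sub>R (ys b - xs b) = - ((1/m) *\<^sub>R b)"
      by (metis, metis minus_diff_eq scaleR_minus_right)
    then have "p + (1/m) *\<^sub>R b \<in> S" "p - (1/m) *\<^sub>R b \<in> S"
      using in_S by (simp_all only: diff_conv_add_uminus)
    then show "b \<in> U"
      unfolding U_def using m by (intro CollectI exI[of _ "1/m"]) simp
  qed
  then have "rspace k \<subseteq> U"
    using span_minimal[OF _ \<open>subspace U\<close>] span_basis_rspace[OF B(2) Br B(3)] by blast
  then have "p \<in> core k S"
    using \<open>p \<in> S\<close> assms by (auto simp: core_def U_def)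
  then show ?thesis by blast
qed

section \<open>Polyhedra and elimination of the vertical coordinate\<close>

definition polyh :: "nat \<Rightarrow> ('l \<Rightarrow> vec \<times> real) \<Rightarrow> 'l set \<Rightarrow> vec set" where
  "polyh k c A = {x \<in> rspace k. \<forall>h\<in>A. 0 \<le> ev k (c h) x}"

text \<open>The equation a = 0, solved for the vertical coordinate, is substituted into h. If the
  vertical coefficient of a is nonzero, a itself becomes the zero functional; an h whose vertical
  coefficient is 0 is returned unchanged.\<close>

definition elim :: "nat \<Rightarrow> vec \<times> real \<Rightarrow> vec \<times> real \<Rightarrow> vec \<times> real" where
  "elim k a h = (\<lambda>i. fst h i - fst h k / fst a k * fst a i, snd h - fst h k / fst a k * snd a)"

text \<open>Valid off the hyperplane a = 0 as well: the correction is a multiple of the value of a,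
  and its sign decides all lifting arguments.\<close>

lemma ev_elim:
  assumes "fst a k \<noteq> 0"
  shows "ev k (elim k a h) x = ev (Suc k) h x - fst h k / fst a k * ev (Suc k) a x"
proof -
  have "lin k (elim k a h) x = lin k h x - fst h k / fst a k * lin k a x"
    by (simp only: lin_def elim_def fst_conv left_diff_distrib sum_subtractf sum_distrib_left mult.assoc)
  moreover have "snd (elim k a h) = snd h - fst h k / fst a k * snd a"
    by (simp add: elim_def)
  ultimately have "ev k (elim k a h) x = ev k h x - fst h k / fst a k * ev k a x"
    by (simp add: ev_def distrib_left)
  then show ?thesis
    using assms by (simp add: ev_Suc distrib_left)
qed

lemma polyh_subset_rspace: "polyh k c A \<subseteq> rspace k"
  by (auto simp: polyh_def)

lemma convex_polyh: "convex (polyh k c A)"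
proof (rule convexI)
  fix x y u v assume "x \<in> polyh k c A" "y \<in> polyh k c A" and uv: "0 \<le> u" "0 \<le> v" "u + v = (1::real)"
  then show "u *\<^sub>R x + v *\<^sub>R y \<in> polyh k c A"
    by (simp add: polyh_def ev_affine rspace_add rspace_scaleR)
qed

text \<open>A constraint that is tight at p and satisfied on both sides of p along every line cannot
  vary at all. Conversely, finitely many strict inequalities survive a short move.\<close>

lemma core_polyh:
  assumes "finite A"
  shows "p \<in> core k (polyh k c A) \<longleftrightarrow>
    p \<in> rspace k \<and> (\<forall>h\<in>A. 0 < ev k (c h) p \<or> (\<forall>x\<in>rspace k. ev k (c h) x = 0))"
proof (intro iffI conjI ballI)
  assume p: "p \<in> core k (polyh k c A)"
  then show "p \<in> rspace k" by (simp add: core_def)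
  fix h assume h: "h \<in> A"
  have "0 \<le> ev k (c h) p"
    using core_subset[OF p] h by (simp add: polyh_def)
  moreover have "ev k (c h) x = 0" if "ev k (c h) p = 0" "x \<in> rspace k" for x
  proof -
    have "x - p \<in> rspace k" using that \<open>p \<in> rspace k\<close> rspace_diff by blast
    then obtain e where e: "e > 0" "p + e *\<^sub>R (x - p) \<in> polyh k c A" "p - e *\<^sub>R (x - p) \<in> polyh k c A"
      using p by (auto simp: core_def)
    then have "0 \<le> ev k (c h) (p + e *\<^sub>R (x - p))" "0 \<le> ev k (c h) (p - e *\<^sub>R (x - p))"
      using h by (simp_all add: polyh_def)
    then have "e * lin k (c h) (x - p) = 0"
      using that(1) by (simp add: ev_add_scaleR ev_diff_scaleR)
    then have "lin k (c h) (x - p) = 0" using e(1) by simp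
    then show ?thesis using that(1) by (simp add: lin_eq_ev_diff)
  qed
  ultimately show "0 < ev k (c h) p \<or> (\<forall>x\<in>rspace k. ev k (c h) x = 0)"
    by fastforce
next
  assume *: "p \<in> rspace k \<and> (\<forall>h\<in>A. 0 < ev k (c h) p \<or> (\<forall>x\<in>rspace k. ev k (c h) x = 0))"
  have "\<exists>e>0. p + e *\<^sub>R v \<in> polyh k c A \<and> p - e *\<^sub>R v \<in> polyh k c A" if v: "v \<in> rspace k" for v
  proof -
    have in_rspace: "p + e *\<^sub>R v \<in> rspace k" "p - e *\<^sub>R v \<in> rspace k" for e
      using * v by (simp_all add: rspace_add rspace_diff rspace_scaleR)
    have "\<forall>\<^sub>F e in at_right 0. 0 \<le> ev k (c h) (p + e *\<^sub>R v) \<and> 0 \<le> ev k (c h) (p - e *\<^sub>R v)"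
      if h: "h \<in> A" for h
    proof (cases "\<forall>x\<in>rspace k. ev k (c h) x = 0")
      case True
      then show ?thesis using in_rspace by simp
    next
      case False
      then have pos: "0 < ev k (c h) p" using * h by blast
      have "((\<lambda>e. ev k (c h) p + e * lin k (c h) v) \<longlongrightarrow> ev k (c h) p + 0 * lin k (c h) v) (at_right 0)"
        "((\<lambda>e. ev k (c h) p - e * lin k (c h) v) \<longlongrightarrow> ev k (c h) p - 0 * lin k (c h) v) (at_right 0)"
        by (intro tendsto_intros)+
      then have "\<forall>\<^sub>F e in at_right 0. 0 < ev k (c h) p + e * lin k (c h) v"
        "\<forall>\<^sub>F e in at_right 0. 0 < ev k (c h) p - e * lin k (c h) v"
        using pos order_tendstoD(1) by fastforce+
      then show ?thesis
        by eventually_elim (simp add: ev_add_scaleR ev_diff_scaleR)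
    qed
    then have "\<forall>\<^sub>F e in at_right 0. \<forall>h\<in>A. 0 \<le> ev k (c h) (p + e *\<^sub>R v) \<and> 0 \<le> ev k (c h) (p - e *\<^sub>R v)"
      using assms by (simp add: eventually_ball_finite)
    moreover have "\<forall>\<^sub>F e in at_right 0. (0::real) < e"
      by (simp add: eventually_at_right_less)
    ultimately have "\<forall>\<^sub>F e in at_right 0. 0 < e \<and> p + e *\<^sub>R v \<in> polyh k c A \<and> p - e *\<^sub>R v \<in> polyh k c A"
      by eventually_elim (simp add: polyh_def in_rspace)
    then show ?thesis
      using eventually_happens' trivial_limit_at_right_real by blast
  qed
  then show "p \<in> core k (polyh k c A)"
    using * by (simp add: core_def)
qed

lemma ev_not_zero_everywhere:
  assumes "fst f k \<noteq> 0"
  shows "\<exists>x\<in>rspace (Suc k). ev (Suc k) f x \<noteq> 0"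
proof (rule ccontr)
  assume "\<not> ?thesis"
  then have "ev (Suc k) f 0 = 0" "ev (Suc k) f (0 + 1 *\<^sub>R unitv k) = 0"
    using rspace_zero rspace_lift[of 0 k 1] by auto
  then show False
    unfolding ev_Suc_add_unitv using assms by simp
qed

text \<open>Constraints that drop out become the zero functional, which keeps the set of labels fixed.\<close>

fun upd :: "nat \<Rightarrow> ('l \<Rightarrow> vec \<times> real) \<Rightarrow> 'l option \<times> 'l option \<Rightarrow> 'l \<Rightarrow> vec \<times> real" where
  "upd k c (Some a, Some b) = (\<lambda>h. if h \<noteq> a \<and> fst (c h) k < 0 then elim k (c a) (c h) else elim k (c b) (c h))"
| "upd k c (Some a, None) = (\<lambda>h. elim k (c a) (c h))"
| "upd k c (None, Some b) = (\<lambda>h. elim k (c b) (c h))"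
| "upd k c (None, None) = (\<lambda>h. if fst (c h) k = 0 then c h else (0, 0))"

lemma ev_zero_pair: "ev k (0, 0) x = 0"
  by (simp add: ev_def lin_def)

text \<open>The last clause is what allows \<open>upd\<close> to drop the constraints with nonzero
  vertical coefficient when there is neither ceiling nor floor. It is a property of the polyhedron
  and cannot be read off the label.\<close>

definition admissible :: "nat \<Rightarrow> ('l \<Rightarrow> vec \<times> real) \<Rightarrow> 'l set \<Rightarrow> 'l option \<times> 'l option \<Rightarrow> bool" where
  "admissible k c A p \<longleftrightarrow> (\<forall>a. fst p = Some a \<longrightarrow> a \<in> A \<and> fst (c a) k < 0)
    \<and> (\<forall>b. snd p = Some b \<longrightarrow> b \<in> A \<and> fst (c b) k > 0)
    \<and> (p = (None, None) \<longrightarrow> polyh (Suc k) c A = polyh (Suc k) c {h \<in> A. fst (c h) k = 0})"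

text \<open>The lifted point is \<open>w s\<close>; it depends only on the facet and on z, so that it serves two
  polyhedra with the same facet at once.\<close>

lemma core_lift_one_sided:
  assumes "finite A" "a \<in> A" "fst (c a) k \<noteq> 0" "core (Suc k) (polyh (Suc k) c A) \<noteq> {}"
    and z: "z \<in> core k (polyh k (\<lambda>h. elim k (c a) (c h)) A)"
  defines "w s \<equiv> z + ((s - ev k (c a) z) / fst (c a) k) *\<^sub>R unitv k"
  shows "\<forall>\<^sub>F s in at_right 0. w s \<in> core (Suc k) (polyh (Suc k) c A)"
proof -
  obtain p where p: "p \<in> core (Suc k) (polyh (Suc k) c A)" using assms by blast
  have zr: "z \<in> rspace k" using z by (simp add: core_def)
  have ev_a: "ev (Suc k) (c a) (w s) = s" for s
    using assms(3) zr by (simp add: w_def ev_Suc_add_unitv) (simp add: ev_Suc rspace_def)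
  have ev_h: "ev (Suc k) (c h) (w s) = ev k (elim k (c a) (c h)) z + fst (c h) k / fst (c a) k * s" for h s
  proof -
    have "ev k (elim k (c a) (c h)) (w s) = ev k (elim k (c a) (c h)) (vproj k (w s))" by simp
    also have "vproj k (w s) = z" using zr by (simp add: w_def vproj_lift)
    finally show ?thesis using ev_elim[of "c a" k "c h" "w s"] assms(3) by (simp add: ev_a)
  qed
  have "\<forall>\<^sub>F s in at_right 0. 0 < ev (Suc k) (c h) (w s) \<or> (\<forall>x\<in>rspace (Suc k). ev (Suc k) (c h) x = 0)"
    if h: "h \<in> A" for h
  proof (cases "0 < ev k (elim k (c a) (c h)) z")
    case True
    have "((\<lambda>s. ev k (elim k (c a) (c h)) z + fst (c h) k / fst (c a) k * s) \<longlongrightarrow>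
        ev k (elim k (c a) (c h)) z + fst (c h) k / fst (c a) k * 0) (at_right 0)"
      by (intro tendsto_intros)
    then have "\<forall>\<^sub>F s in at_right 0. 0 < ev (Suc k) (c h) (w s)"
      unfolding ev_h using True by (auto intro: order_tendstoD(1))
    then show ?thesis by eventually_elim simp
  next
    case False
    then have zero: "\<forall>x\<in>rspace k. ev k (elim k (c a) (c h)) x = 0"
      using z assms(1) h by (auto simp: core_polyh)
    \<comment> \<open>If h vanishes on the hyperplane of a, it is a multiple of a. The interior
      point p, where a is positive and h is not negative, excludes a negative factor, so h is
      identically zero or positive just behind the facet.\<close>
    have ratio: "ev (Suc k) (c h) x = fst (c h) k / fst (c a) k * ev (Suc k) (c a) x" for x
    proof -
      have "ev k (elim k (c a) (c h)) x = 0"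
        using zero vproj_in_rspace ev_vproj by metis
      then show ?thesis using ev_elim[of "c a" k "c h" x] assms(3) by simp
    qed
    have pa: "0 < ev (Suc k) (c a) p"
      using p assms(1,2) ev_not_zero_everywhere[OF assms(3)] by (auto simp: core_polyh)
    have "0 \<le> ev (Suc k) (c h) p"
      using core_subset[OF p] h by (simp add: polyh_def)
    then have "0 \<le> fst (c h) k / fst (c a) k"
      using pa unfolding ratio[of p] zero_le_mult_iff by linarith
    then consider "fst (c h) k / fst (c a) k = 0" | "0 < fst (c h) k / fst (c a) k" by linarith
    then show ?thesis
    proof cases
      case 1
      then have "\<forall>x\<in>rspace (Suc k). ev (Suc k) (c h) x = 0"
        unfolding ratio by auto
      then show ?thesis by simp
    next
      case 2
      have "\<forall>\<^sub>F s in at_right 0. (0::real) < s" by (simp add: eventually_at_right_less)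
      then show ?thesis
      proof eventually_elim
        case (elim s)
        then have "0 < ev (Suc k) (c h) (w s)"
          unfolding ratio[of "w s"] ev_a using 2 by (rule mult_pos_pos[rotated])
        then show ?case by simp
      qed
    qed
  qed
  then have "\<forall>\<^sub>F s in at_right 0. \<forall>h\<in>A. 0 < ev (Suc k) (c h) (w s) \<or> (\<forall>x\<in>rspace (Suc k). ev (Suc k) (c h) x = 0)"
    using assms(1) by (simp add: eventually_ball_finite)
  then show ?thesis
    by eventually_elim (use assms(1) zr in \<open>simp add: core_polyh w_def rspace_lift\<close>)
qed

text \<open>At w a constraint bounding from above equals its value on the ceiling plus a positive
  multiple of the value of a, because both vertical coefficients are negative. Constraints bounding
  from below behave in the same way with b, and the others do not change along the vertical line
  through z.\<close>

lemma core_lift_two_sided: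
  assumes "finite A" "a \<in> A" "b \<in> A" "fst (c a) k < 0" "fst (c b) k > 0"
    and z: "z \<in> core k (polyh k (upd k c (Some a, Some b)) A)"
    and w: "w = z + t *\<^sub>R unitv k" "0 < ev (Suc k) (c a) w" "0 < ev (Suc k) (c b) w"
  shows "w \<in> core (Suc k) (polyh (Suc k) c A)"
proof -
  have zr: "z \<in> rspace k" using z by (simp add: core_def)
  have vp: "vproj k w = z" using zr w by (simp add: vproj_lift)
  have el: "ev (Suc k) (c h) w = ev k (elim k (c d) (c h)) z + fst (c h) k / fst (c d) k * ev (Suc k) (c d) w"
    if "fst (c d) k \<noteq> 0" for h d
    using ev_elim[OF that, of "c h" w] ev_vproj[of k "elim k (c d) (c h)" w] by (simp add: vp)
  have "0 < ev (Suc k) (c h) w \<or> (\<forall>x\<in>rspace (Suc k). ev (Suc k) (c h) x = 0)" if h: "h \<in> A" for h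
  proof -
    have u: "0 \<le> ev k (upd k c (Some a, Some b) h) z"
      using core_subset[OF z] h by (simp add: polyh_def)
    consider "h = a" | "h \<noteq> a" "fst (c h) k < 0" | "h \<noteq> a" "fst (c h) k = 0" | "h \<noteq> a" "fst (c h) k > 0"
      by linarith
    then show ?thesis
    proof cases
      case 1
      then show ?thesis using w by simp
    next
      case 2
      have "0 < fst (c h) k / fst (c a) k * ev (Suc k) (c a) w"
        using 2 assms(4) w(2) by (intro mult_pos_pos divide_neg_neg)
      then show ?thesis using u 2 el[of a h] assms(4) by simp
    next
      case 3
      then have "elim k (c b) (c h) = c h" by (simp add: elim_def)
      then have u': "upd k c (Some a, Some b) h = c h" using 3 by simp
      have e: "ev (Suc k) (c h) x = ev k (c h) (vproj k x)" for x
        using 3 by (simp add: ev_Suc)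
      have "0 < ev k (c h) z \<or> (\<forall>x\<in>rspace k. ev k (c h) x = 0)"
        using z assms(1) h u' by (simp only: core_polyh) metis
      then show ?thesis unfolding e vp using vproj_in_rspace by blast
    next
      case 4
      have "0 < fst (c h) k / fst (c b) k * ev (Suc k) (c b) w"
        using 4 assms(5) w(3) by (simp add: zero_less_mult_iff)
      then show ?thesis using u 4 el[of b h] assms(5) by simp
    qed
  qed
  then show ?thesis using assms(1) w zr by (simp add: core_polyh rspace_lift)
qed

text \<open>The contrapositive is the step of the main induction: if two polyhedra have disjoint
  interiors, so have their bases with a common label. The point lifted from z must therefore be
  chosen from c, p and z alone, up to a smallness condition that both polyhedra can meet.\<close>

lemma core_lift:
  assumes "finite A" "finite A'" "admissible k c A p" "admissible k c A' p"
    and ne: "core (Suc k) (polyh (Suc k) c A) \<noteq> {}" "core (Suc k) (polyh (Suc k) c A') \<noteq> {}"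
    and z: "z \<in> core k (polyh k (upd k c p) A)" "z \<in> core k (polyh k (upd k c p) A')"
  shows "core (Suc k) (polyh (Suc k) c A) \<inter> core (Suc k) (polyh (Suc k) c A') \<noteq> {}"
proof -
  have zr: "z \<in> rspace k" using z by (simp add: core_def)
  have one: ?thesis if "a \<in> A" "a \<in> A'" "fst (c a) k \<noteq> 0" "upd k c p = (\<lambda>h. elim k (c a) (c h))" for a
  proof -
    define w where "w s = z + ((s - ev k (c a) z) / fst (c a) k) *\<^sub>R unitv k" for s
    have "\<forall>\<^sub>F s in at_right 0. w s \<in> core (Suc k) (polyh (Suc k) c A)"
      "\<forall>\<^sub>F s in at_right 0. w s \<in> core (Suc k) (polyh (Suc k) c A')"
      unfolding w_def using assms that by (auto intro!: core_lift_one_sided)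
    then have "\<forall>\<^sub>F s in at_right 0. w s \<in> core (Suc k) (polyh (Suc k) c A) \<inter> core (Suc k) (polyh (Suc k) c A')"
      by eventually_elim simp
    then show ?thesis
      using eventually_happens' trivial_limit_at_right_real by blast
  qed
  show ?thesis
  proof (cases "fst p")
    case None
    show ?thesis
    proof (cases "snd p")
      case None
      with \<open>fst p = None\<close> have p: "p = (None, None)" by (simp add: prod_eq_iff)
      have "z \<in> core (Suc k) (polyh (Suc k) c B)"
        if B: "finite B" "z \<in> core k (polyh k (upd k c p) B)" "admissible k c B p" for B
      proof -
        have e: "ev (Suc k) (c h) x = ev k (c h) (vproj k x)" if "fst (c h) k = 0" for h x
          using that by (simp add: ev_Suc)
        have "0 < ev k (upd k c p h) z \<or> (\<forall>x\<in>rspace k. ev k (upd k c p h) x = 0)" if "h \<in> B" for h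
          using B(1,2) that by (simp add: core_polyh)
        then have "0 < ev k (c h) z \<or> (\<forall>x\<in>rspace k. ev k (c h) x = 0)" if "h \<in> B" "fst (c h) k = 0" for h
          using that p by fastforce
        then have "z \<in> core (Suc k) (polyh (Suc k) c {h \<in> B. fst (c h) k = 0})"
          using B(1) zr vproj_in_rspace by (fastforce simp: core_polyh e vproj_ident rspace_Suc_mono)
        then show ?thesis using B(3) p by (simp add: admissible_def)
      qed
      then show ?thesis using assms by blast
    next
      case (Some b)
      with None have "p = (None, Some b)" by (simp add: prod_eq_iff)
      then show ?thesis using assms Some by (intro one[of b]) (auto simp: admissible_def)
    qed
  next
    case (Some a)
    show ?thesis
    proof (cases "snd p")
      case None
      with Some have "p = (Some a, None)" by (simp add: prod_eq_iff)
      then show ?thesis using assms Some by (intro one[of a]) (auto simp: admissible_def)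
    next
      case (Some b)
      with \<open>fst p = Some a\<close> have p: "p = (Some a, Some b)" by (simp add: prod_eq_iff)
      have ab: "a \<in> A" "a \<in> A'" "b \<in> A" "b \<in> A'" "fst (c a) k < 0" "fst (c b) k > 0"
        using assms p by (auto simp: admissible_def)
      define \<alpha> \<beta> where "\<alpha> = ev k (c a) z" and "\<beta> = ev k (c b) z"
      obtain q where q: "q \<in> core (Suc k) (polyh (Suc k) c A)" using ne by blast
      then have q_pos: "0 < ev (Suc k) (c a) q" "0 < ev (Suc k) (c b) q"
        using ab assms(1) ev_not_zero_everywhere[of "c a" k] ev_not_zero_everywhere[of "c b" k]
        by (auto simp: core_polyh)
      \<comment> \<open>The functional is positive somewhere, which rules out the identically zero
        alternative of \<open>core_polyh\<close> at z.\<close>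
      have elim_q: "0 < ev k (elim k (c b) (c a)) (vproj k q)"
      proof -
        have "fst (c a) k / fst (c b) k * ev (Suc k) (c b) q < 0"
          using ab q_pos by (intro mult_neg_pos divide_neg_pos)
        then show ?thesis using ev_elim[of "c b" k "c a" q] ab q_pos by simp
      qed
      \<comment> \<open>This is why \<open>upd\<close> treats the label a separately: it carries the
        condition that the ceiling lies above the floor. Eliminating a from itself would give the
        zero functional and lose that condition.\<close>
      have "upd k c p a = elim k (c b) (c a)" using p by simp
      then have "0 < ev k (elim k (c b) (c a)) z"
        using z(1) assms(1) ab(1) elim_q vproj_in_rspace[of k q] by (metis core_polyh less_irrefl)
      moreover have "ev k (elim k (c b) (c a)) z = \<alpha> - fst (c a) k / fst (c b) k * \<beta>"
        using ev_elim[of "c b" k "c a" z] ab zr by (simp add: \<alpha>_def \<beta>_def ev_Suc rspace_def)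
      \<comment> \<open>The two sides are the heights of floor and ceiling above z.\<close>
      ultimately have "- \<beta> / fst (c b) k < - \<alpha> / fst (c a) k"
        using ab by (simp add: field_simps)
      then obtain t where t: "- \<beta> / fst (c b) k < t" "t < - \<alpha> / fst (c a) k"
        using dense by blast
      define w where "w = z + t *\<^sub>R unitv k"
      have "0 < ev (Suc k) (c a) w" "0 < ev (Suc k) (c b) w"
        using t ab zr by (simp_all add: w_def ev_Suc_add_unitv) (simp_all add: ev_Suc rspace_def \<alpha>_def \<beta>_def field_simps)
      then have "w \<in> core (Suc k) (polyh (Suc k) c A)" "w \<in> core (Suc k) (polyh (Suc k) c A')"
        using core_lift_two_sided[OF _ ab(1,3,5,6), of z w t] core_lift_two_sided[OF _ ab(2,4,5,6), of z w t]
          assms p by (auto simp: w_def)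
      then show ?thesis by blast
    qed
  qed
qed

section \<open>Vertical projections of facets\<close>

text \<open>The midpoint of a point that serves N and a point that serves b serves both, since no
  functional is negative on F.\<close>

lemma convex_all_positive:
  assumes "finite N" "convex F" "F \<noteq> {}" "\<And>a p. a \<in> N \<Longrightarrow> p \<in> F \<Longrightarrow> 0 \<le> ev k (c a) p"
    "\<And>a. a \<in> N \<Longrightarrow> \<exists>p\<in>F. 0 < ev k (c a) p"
  shows "\<exists>p\<in>F. \<forall>a\<in>N. 0 < ev k (c a) p"
  using assms(1,4,5)
proof (induction N)
  case empty
  then show ?case using assms(3) by blast
next
  case (insert b N)
  then obtain p q where p: "p \<in> F" "\<forall>a\<in>N. 0 < ev k (c a) p" and q: "q \<in> F" "0 < ev k (c b) q"
    by (metis insertCI)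
  define r where "r = (1/2) *\<^sub>R p + (1/2) *\<^sub>R q"
  have ev_r: "ev k (c a) r = (ev k (c a) p + ev k (c a) q) / 2" for a
    by (simp add: r_def ev_affine add_divide_distrib)
  have "r \<in> F"
    unfolding r_def using assms(2) p q by (intro convexD) auto
  moreover have "0 < ev k (c a) r" if "a \<in> insert b N" for a
  proof (cases "a = b")
    case True
    then show ?thesis unfolding ev_r using insert.prems(1)[of b p] p q by simp
  next
    case False
    then have "0 < ev k (c a) p" "0 \<le> ev k (c a) q"
      using insert.prems(1)[of a q] p q that by auto
    then show ?thesis unfolding ev_r by (simp add: add_pos_nonneg)
  qed
  ultimately show ?case by blast
qed

text \<open>Otherwise each constraint opposing the direction would be positive somewhere on F, hence
  all of them at one point of F, and that point could be moved a little in the direction without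
  leaving the polyhedron. The sign \<sigma> is 1 for upper and -1 for lower facets.\<close>

lemma vertical_facet_constraint:
  assumes "finite A" "convex F" "F \<noteq> {}" "F \<subseteq> polyh (Suc k) c A"
    and out: "\<forall>p\<in>F. \<forall>t>0. p + t *\<^sub>R (\<sigma> *\<^sub>R unitv k) \<notin> polyh (Suc k) c A"
  shows "\<exists>a\<in>A. \<sigma> * fst (c a) k < 0 \<and> (\<forall>p\<in>F. ev (Suc k) (c a) p = 0)"
proof (rule ccontr)
  assume neg: "\<not> ?thesis"
  define N where "N = {a\<in>A. \<sigma> * fst (c a) k < 0}"
  have nonneg: "0 \<le> ev (Suc k) (c a) p" if "a \<in> A" "p \<in> F" for a p
    using that assms(4) by (auto simp: polyh_def)
  have "\<exists>p\<in>F. 0 < ev (Suc k) (c a) p" if "a \<in> N" for a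
    using neg that nonneg by (fastforce simp: N_def)
  then obtain p where p: "p \<in> F" "\<forall>a\<in>N. 0 < ev (Suc k) (c a) p"
    using convex_all_positive[of N F "Suc k" c] assms nonneg by (auto simp: N_def)
  have ev_t: "ev (Suc k) (c a) (p + t *\<^sub>R (\<sigma> *\<^sub>R unitv k)) = ev (Suc k) (c a) p + t * (\<sigma> * fst (c a) k)" for a t
    by (simp add: ev_add_scaleR lin_scaleR lin_unitv)
  have "\<forall>\<^sub>F t in at_right 0. 0 \<le> ev (Suc k) (c a) (p + t *\<^sub>R (\<sigma> *\<^sub>R unitv k))" if a: "a \<in> A" for a
  proof (cases "a \<in> N")
    case True
    have "((\<lambda>t. ev (Suc k) (c a) p + t * (\<sigma> * fst (c a) k)) \<longlongrightarrow> ev (Suc k) (c a) p + 0 * (\<sigma> * fst (c a) k)) (at_right 0)"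
      by (intro tendsto_intros)
    then have "\<forall>\<^sub>F t in at_right 0. 0 < ev (Suc k) (c a) p + t * (\<sigma> * fst (c a) k)"
      using p(2) True order_tendstoD(1) by fastforce
    then show ?thesis
      unfolding ev_t by eventually_elim simp
  next
    case False
    then have "0 \<le> \<sigma> * fst (c a) k" using a by (simp add: N_def)
    then have "0 \<le> ev (Suc k) (c a) p + t * (\<sigma> * fst (c a) k)" if "0 < t" for t
      using that by (intro add_nonneg_nonneg[OF nonneg[OF a p(1)] mult_nonneg_nonneg]) auto
    moreover have "\<forall>\<^sub>F t in at_right 0. (0::real) < t"
      by (simp add: eventually_at_right_less)
    ultimately show ?thesis
      unfolding ev_t by (auto elim: eventually_mono)
  qed
  then have "\<forall>\<^sub>F t in at_right 0. \<forall>a\<in>A. 0 \<le> ev (Suc k) (c a) (p + t *\<^sub>R (\<sigma> *\<^sub>R unitv k))"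
    using assms(1) by (simp add: eventually_ball_finite)
  moreover have "\<forall>\<^sub>F t in at_right 0. (0::real) < t"
    by (simp add: eventually_at_right_less)
  ultimately have "\<forall>\<^sub>F t in at_right 0. 0 < t \<and> (\<forall>a\<in>A. 0 \<le> ev (Suc k) (c a) (p + t *\<^sub>R (\<sigma> *\<^sub>R unitv k)))"
    by eventually_elim simp
  then obtain t where t: "0 < t" "\<forall>a\<in>A. 0 \<le> ev (Suc k) (c a) (p + t *\<^sub>R (\<sigma> *\<^sub>R unitv k))"
    using eventually_happens' trivial_limit_at_right_real by blast
  have "p + t *\<^sub>R (\<sigma> *\<^sub>R unitv k) \<in> rspace (Suc k)"
    using p(1) assms(4) by (auto simp: polyh_def intro!: rspace_add rspace_scaleR unitv_in_rspace)
  then show False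
    using t p(1) out by (auto simp: polyh_def)
qed

lemma graph_unique:
  assumes "x \<in> rspace (Suc k)" "y \<in> rspace (Suc k)" "vproj k x = vproj k y"
    "ev (Suc k) f x = ev (Suc k) f y" "fst f k \<noteq> 0"
  shows "x = y"
proof -
  have "ev k f x = ev k f y"
    using assms(3) ev_vproj by metis
  then have "x k = y k"
    using assms(4,5) by (simp add: ev_Suc)
  then show ?thesis
    using vproj_Suc_decomp[OF assms(1)] vproj_Suc_decomp[OF assms(2)] assms(3) by metis
qed

text \<open>A face contained in the zero set of a need not fill it. Here p lies over an interior
  point of the projection, so the segment from any q of the zero set to p can be prolonged to a
  point r of F: on the hyperplane of a a point is determined by its projection. Then p is inside the
  segment from q to r, and the face property gives q in F.\<close>

lemma face_eq_of_core:
  assumes "F face_of polyh (Suc k) c A" "fst (c a) k \<noteq> 0" "\<forall>p\<in>F. ev (Suc k) (c a) p = 0"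
    and "core k (vproj k ` F) \<noteq> {}"
  shows "F = {x \<in> polyh (Suc k) c A. ev (Suc k) (c a) x = 0}"
proof
  show "F \<subseteq> {x \<in> polyh (Suc k) c A. ev (Suc k) (c a) x = 0}"
    using assms face_of_imp_subset by blast
  show "{x \<in> polyh (Suc k) c A. ev (Suc k) (c a) x = 0} \<subseteq> F"
  proof safe
    fix q assume q: "q \<in> polyh (Suc k) c A" "ev (Suc k) (c a) q = 0"
    obtain p' where p': "p' \<in> core k (vproj k ` F)" using assms by blast
    then obtain p where p: "p \<in> F" "p' = vproj k p" using core_subset by blast
    have pS: "p \<in> polyh (Suc k) c A" using p assms(1) face_of_imp_subset by blast
    have rs: "p \<in> rspace (Suc k)" "q \<in> rspace (Suc k)"
      using pS q polyh_subset_rspace by blast+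
    have "vproj k p - vproj k q \<in> rspace k"
      by (simp add: rspace_diff vproj_in_rspace)
    then obtain e r where e: "e > 0" "r \<in> F" "vproj k p + e *\<^sub>R (vproj k p - vproj k q) = vproj k r"
      using p' p unfolding core_def by blast
    have rS: "r \<in> polyh (Suc k) c A" using e assms(1) face_of_imp_subset by blast
    have "vproj k (p - q) = vproj k p - vproj k q"
      by (auto simp: vproj_def fun_eq_iff)
    then have "vproj k (p + e *\<^sub>R (p - q)) = vproj k r"
      unfolding vproj_add_scaleR using e(3) by simp
    moreover have "ev (Suc k) (c a) (p + e *\<^sub>R (p - q)) = ev (Suc k) (c a) r"
      unfolding ev_add_scaleR lin_eq_ev_diff using assms(3) p(1) e(2) q(2) by simp
    moreover have "p + e *\<^sub>R (p - q) \<in> rspace (Suc k)" "r \<in> rspace (Suc k)"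
      using rS polyh_subset_rspace by (auto intro!: rspace_add rspace_scaleR rspace_diff rs)
    ultimately have "r = p + e *\<^sub>R (p - q)"
      using graph_unique[OF _ _ _ _ assms(2)] by metis
    then have r: "(1 + e) *\<^sub>R p = r + e *\<^sub>R q"
      by (simp add: algebra_simps)
    show "q \<in> F"
    proof (cases "q = r")
      case True
      then show ?thesis using e by simp
    next
      case False
      define u where "u = 1 / (1 + e)"
      have u: "0 < u" "u < 1" "u * (1 + e) = 1" "1 - u = u * e"
        using e by (auto simp: u_def field_simps)
      have "p = u *\<^sub>R ((1 + e) *\<^sub>R p)"
        by (simp only: scaleR_scaleR u(3) scaleR_one)
      also have "\<dots> = (1 - u) *\<^sub>R q + u *\<^sub>R r"
        unfolding r u(4) by (simp add: scaleR_right_distrib add.commute)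
      finally have "p \<in> open_segment q r"
        using False u unfolding in_segment by blast
      then show ?thesis
        using face_ofD[OF assms(1) _ q(1) rS p(1)] by blast
    qed
  qed
qed

lemma vproj_facet:
  assumes "fst (c a) k \<noteq> 0"
  shows "vproj k ` {x \<in> polyh (Suc k) c A. ev (Suc k) (c a) x = 0} = polyh k (\<lambda>h. elim k (c a) (c h)) A"
proof
  show "vproj k ` {x \<in> polyh (Suc k) c A. ev (Suc k) (c a) x = 0} \<subseteq> polyh k (\<lambda>h. elim k (c a) (c h)) A"
  proof safe
    fix x assume x: "x \<in> polyh (Suc k) c A" "ev (Suc k) (c a) x = 0"
    have "ev k (elim k (c a) (c h)) (vproj k x) = ev (Suc k) (c h) x" for h
      unfolding ev_vproj ev_elim[OF assms] using x(2) by simp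
    then show "vproj k x \<in> polyh k (\<lambda>h. elim k (c a) (c h)) A"
      using x(1) by (simp add: polyh_def vproj_in_rspace)
  qed
  show "polyh k (\<lambda>h. elim k (c a) (c h)) A \<subseteq> vproj k ` {x \<in> polyh (Suc k) c A. ev (Suc k) (c a) x = 0}"
  proof
    fix z assume z: "z \<in> polyh k (\<lambda>h. elim k (c a) (c h)) A"
    then have zr: "z \<in> rspace k" using polyh_subset_rspace by blast
    define t where "t = - ev (Suc k) (c a) z / fst (c a) k"
    define x where "x = z + t *\<^sub>R unitv k"
    have ev_x: "ev (Suc k) (c a) x = 0"
      using assms unfolding x_def ev_Suc_add_unitv t_def by simp
    have vp: "vproj k x = z" using zr by (simp add: x_def vproj_lift)
    have "ev (Suc k) (c h) x = ev k (elim k (c a) (c h)) z" for h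
      using ev_elim[of "c a" k "c h" x] assms ev_vproj[of k "elim k (c a) (c h)" x] by (simp add: ev_x vp)
    then have "x \<in> polyh (Suc k) c A"
      using z zr by (simp add: polyh_def x_def rspace_lift)
    then show "z \<in> vproj k ` {x \<in> polyh (Suc k) c A. ev (Suc k) (c a) x = 0}"
      using ev_x vp by blast
  qed
qed

text \<open>Between ceiling a and floor b, a constraint h that bounds from above needs to be imposed on the
  ceiling only, and every other one on the floor only.\<close>

lemma polyh_Int_elim:
  assumes "a \<in> A" "b \<in> A" "fst (c a) k < 0" "fst (c b) k > 0"
  shows "polyh k (\<lambda>h. elim k (c a) (c h)) A \<inter> polyh k (\<lambda>h. elim k (c b) (c h)) A
    = polyh k (upd k c (Some a, Some b)) A"
proof
  show "polyh k (\<lambda>h. elim k (c a) (c h)) A \<inter> polyh k (\<lambda>h. elim k (c b) (c h)) A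
      \<subseteq> polyh k (upd k c (Some a, Some b)) A"
    by (auto simp: polyh_def)
  show "polyh k (upd k c (Some a, Some b)) A
      \<subseteq> polyh k (\<lambda>h. elim k (c a) (c h)) A \<inter> polyh k (\<lambda>h. elim k (c b) (c h)) A"
  proof
    fix z assume z: "z \<in> polyh k (upd k c (Some a, Some b)) A"
    then have zr: "z \<in> rspace k" using polyh_subset_rspace by blast
    have u: "0 \<le> ev k (upd k c (Some a, Some b) h) z" if "h \<in> A" for h
      using z that by (simp add: polyh_def)
    define \<alpha> \<beta> where "\<alpha> = ev (Suc k) (c a) z" and "\<beta> = ev (Suc k) (c b) z"
    have ea: "ev k (elim k (c a) (c h)) z = ev (Suc k) (c h) z - fst (c h) k / fst (c a) k * \<alpha>"
      and eb: "ev k (elim k (c b) (c h)) z = ev (Suc k) (c h) z - fst (c h) k / fst (c b) k * \<beta>" for h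
      using ev_elim[of "c a" k "c h" z] ev_elim[of "c b" k "c h" z] assms by (simp_all add: \<alpha>_def \<beta>_def)
    have "0 \<le> \<alpha> - fst (c a) k / fst (c b) k * \<beta>"
      using u[OF assms(1)] eb[of a] by (simp add: \<alpha>_def)
    then have gap: "\<alpha> / fst (c a) k \<le> \<beta> / fst (c b) k"
      using assms by (simp add: field_simps)
    have "0 \<le> ev k (elim k (c a) (c h)) z \<and> 0 \<le> ev k (elim k (c b) (c h)) z" if h: "h \<in> A" for h
    proof -
      consider "h = a" | "h \<noteq> a" "fst (c h) k < 0" | "h \<noteq> a" "fst (c h) k \<ge> 0" by linarith
      then show ?thesis
      proof cases
        case 1
        then show ?thesis using u[OF h] ea[of a] assms by (simp add: \<alpha>_def)
      next
        case 2
        have "fst (c h) k * (\<beta> / fst (c b) k) \<le> fst (c h) k * (\<alpha> / fst (c a) k)"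
          using gap 2 by (intro mult_left_mono_neg) auto
        moreover have "0 \<le> ev k (elim k (c a) (c h)) z" using u[OF h] 2 by simp
        ultimately show ?thesis unfolding ea eb by simp
      next
        case 3
        have "fst (c h) k * (\<alpha> / fst (c a) k) \<le> fst (c h) k * (\<beta> / fst (c b) k)"
          using gap 3 by (intro mult_left_mono) auto
        moreover have "0 \<le> ev k (elim k (c b) (c h)) z" using u[OF h] 3 by simp
        ultimately show ?thesis unfolding ea eb by simp
      qed
    qed
    then show "z \<in> polyh k (\<lambda>h. elim k (c a) (c h)) A \<inter> polyh k (\<lambda>h. elim k (c b) (c h)) A"
      using zr by (simp add: polyh_def)
  qed
qed

text \<open>Such a polyhedron is a cylinder that contains its own base, so a point of the base is
  its own preimage.\<close>

lemma vproj_vertical_polyh: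
  assumes "polyh (Suc k) c A = polyh (Suc k) c {h \<in> A. fst (c h) k = 0}"
  shows "vproj k ` polyh (Suc k) c A = polyh k (upd k c (None, None)) A"
proof
  have e: "ev (Suc k) (c h) x = ev k (c h) x" if "fst (c h) k = 0" for h x
    using that by (simp add: ev_Suc)
  show "vproj k ` polyh (Suc k) c A \<subseteq> polyh k (upd k c (None, None)) A"
    by (auto simp: polyh_def vproj_in_rspace e ev_zero_pair)
  have "polyh k (upd k c (None, None)) A \<subseteq> polyh (Suc k) c {h \<in> A. fst (c h) k = 0}"
    by (auto simp: polyh_def e rspace_Suc_mono split: if_splits)
  then have sub: "polyh k (upd k c (None, None)) A \<subseteq> polyh (Suc k) c A"
    unfolding assms[symmetric] .
  show "polyh k (upd k c (None, None)) A \<subseteq> vproj k ` polyh (Suc k) c A"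
  proof
    fix z assume z: "z \<in> polyh k (upd k c (None, None)) A"
    then have "vproj k z = z" using polyh_subset_rspace vproj_ident by blast
    then show "z \<in> vproj k ` polyh (Suc k) c A" using z sub by (metis image_eqI subsetD)
  qed
qed

section \<open>Affine dimension of polyhedra and of their facets\<close>

lemma adim_eq_dim:
  assumes "subspace V" "V \<subseteq> rspace k" "\<And>x y. x \<in> F \<Longrightarrow> y \<in> F \<Longrightarrow> x - y \<in> V"
    and "q \<in> F" "\<And>v. v \<in> V \<Longrightarrow> \<exists>e>0. q + e *\<^sub>R v \<in> F"
  shows "adim F = dim V"
proof -
  let ?D = "{x - y | x y. x \<in> F \<and> y \<in> F}"
  have "?D \<subseteq> V" using assms(3) by blast
  have "V \<subseteq> span ?D"
  proof
    fix v assume "v \<in> V"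
    then obtain e where e: "e > 0" "q + e *\<^sub>R v \<in> F" using assms(5) by blast
    have "(q + e *\<^sub>R v) - q \<in> ?D" using e assms(4) by blast
    then have "(1/e) *\<^sub>R ((q + e *\<^sub>R v) - q) \<in> span ?D"
      by (intro span_scale span_base)
    then show "v \<in> span ?D" using e by simp
  qed
  moreover have "span ?D \<subseteq> V" using \<open>?D \<subseteq> V\<close> assms(1) by (rule span_minimal)
  ultimately have "span ?D = V" by (rule subset_antisym[rotated])
  then have "dim (span ?D) = dim V" by (rule arg_cong)
  then show ?thesis
    unfolding adim_def dim_span .
qed

lemma adim_of_core:
  assumes "core k S \<noteq> {}" "S \<subseteq> rspace k"
  shows "adim S = k"
proof -
  obtain q where q: "q \<in> core k S" using assms by blast
  have "adim S = dim (rspace k)"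
  proof (rule adim_eq_dim[OF subspace_rspace order_refl])
    show "x - y \<in> rspace k" if "x \<in> S" "y \<in> S" for x y
      using that assms rspace_diff by blast
    show "q \<in> S" using q core_subset by blast
    show "\<exists>e>0. q + e *\<^sub>R v \<in> S" if "v \<in> rspace k" for v
      using q that unfolding core_def by blast
  qed
  then show ?thesis by (simp add: dim_rspace)
qed

lemma subspace_lin_zero: "subspace {v \<in> rspace k. lin k f v = 0}"
  by (simp add: subspace_def rspace_zero rspace_add rspace_scaleR lin_zero lin_add lin_scaleR)

lemma dim_lin_zero:
  assumes "fst f k \<noteq> 0"
  shows "dim {v \<in> rspace (Suc k). lin (Suc k) f v = 0} = k" (is "dim ?V = k")
proof -
  have "unitv k \<in> rspace (Suc k)" "unitv k \<notin> ?V"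
    using assms by (auto simp: unitv_in_rspace lin_unitv)
  then have "?V \<subset> rspace (Suc k)" by blast
  then have "dim ?V < Suc k"
    using dim_less_rspace[OF subspace_lin_zero subspace_rspace, of "Suc k" f "Suc k" "Suc k"]
    by (simp only: dim_rspace order_refl)
  moreover have "Suc k \<le> Suc (dim ?V)"
  proof -
    obtain B where B: "B \<subseteq> ?V" "independent B" "?V \<subseteq> span B" "card B = dim ?V"
      by (rule basis_exists[of ?V])
    then have "finite B" using independent_in_rspace(1)[of B "Suc k"] by blast
    have "rspace (Suc k) \<subseteq> span (insert (unitv k) B)"
    proof
      fix x assume x: "x \<in> rspace (Suc k)"
      define t where "t = lin (Suc k) f x / fst f k"
      have "x - t *\<^sub>R unitv k \<in> ?V"
        using x assms by (simp add: rspace_diff rspace_scaleR unitv_in_rspace lin_diff lin_scaleR lin_unitv t_def)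
      then have "x - t *\<^sub>R unitv k \<in> span B" using B by blast
      then show "x \<in> span (insert (unitv k) B)"
        by (auto simp: span_insert)
    qed
    then have "dim (rspace (Suc k)) \<le> card (insert (unitv k) B)"
      using \<open>finite B\<close> by (intro dim_le_card) auto
    then show ?thesis
      using B(4) \<open>finite B\<close> card_insert_le_m1 by (simp add: dim_rspace card_insert_if split: if_splits)
  qed
  ultimately show ?thesis by simp
qed

section \<open>Labelling the first-stage prisms\<close>

lemma polyh_anti_mono: "B \<subseteq> A \<Longrightarrow> polyh k c A \<subseteq> polyh k c B"
  by (auto simp: polyh_def)

lemma zero_set_face_of: "a \<in> A \<Longrightarrow> {x \<in> polyh k c A. ev k (c a) x = 0} face_of polyh k c A"
  unfolding face_of_def
proof (intro conjI ballI impI)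
  show "convex {x \<in> polyh k c A. ev k (c a) x = 0}"
  proof (rule convexI)
    fix x y u v assume "x \<in> {x \<in> polyh k c A. ev k (c a) x = 0}" "y \<in> {x \<in> polyh k c A. ev k (c a) x = 0}"
      and uv: "0 \<le> u" "0 \<le> v" "u + v = (1::real)"
    then show "u *\<^sub>R x + v *\<^sub>R y \<in> {x \<in> polyh k c A. ev k (c a) x = 0}"
      using convexD[OF convex_polyh, of x k c A y u v] by (simp add: ev_affine)
  qed
  fix x y z
  assume a: "a \<in> A" and x: "x \<in> polyh k c A" and y: "y \<in> polyh k c A"
    and z: "z \<in> {x \<in> polyh k c A. ev k (c a) x = 0}" "z \<in> open_segment x y"
  then obtain u where u: "0 < u" "u < 1" "z = (1 - u) *\<^sub>R x + u *\<^sub>R y"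
    unfolding in_segment by blast
  have "0 \<le> ev k (c a) x" "0 \<le> ev k (c a) y"
    using a x y by (simp_all add: polyh_def)
  moreover have "(1 - u) * ev k (c a) x + u * ev k (c a) y = 0"
    using z(1) u(3) ev_affine[of "1 - u" u k "c a" x y] by simp
  ultimately have "(1 - u) * ev k (c a) x = 0 \<and> u * ev k (c a) y = 0"
    using u(1,2) by (subst (asm) add_nonneg_eq_0_iff) auto
  then have "ev k (c a) x = 0" "ev k (c a) y = 0"
    using u(1,2) by auto
  then show "x \<in> {x \<in> polyh k c A. ev k (c a) x = 0}" "y \<in> {x \<in> polyh k c A. ev k (c a) x = 0}"
    using x y by auto
qed auto

text \<open>A redundant constraint need not cut out a facet. In a description of least cardinality
  every constraint is effective.\<close>

lemma irredundant_subset: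
  assumes "finite A"
  obtains A0 where "A0 \<subseteq> A" "polyh k c A0 = polyh k c A" "\<And>a. a \<in> A0 \<Longrightarrow> polyh k c (A0 - {a}) \<noteq> polyh k c A"
proof -
  define P where "P B \<longleftrightarrow> B \<subseteq> A \<and> polyh k c B = polyh k c A" for B
  have "P A" by (simp add: P_def)
  then obtain A0 where A0: "P A0" "\<And>B. P B \<Longrightarrow> card A0 \<le> card B"
    using ex_has_least_nat[of P A card] by blast
  have fin: "finite A0" using A0(1) assms by (auto simp: P_def dest: finite_subset)
  show ?thesis
  proof (rule that[of A0])
    show "A0 \<subseteq> A" "polyh k c A0 = polyh k c A" using A0(1) by (simp_all add: P_def)
    fix a assume a: "a \<in> A0"
    show "polyh k c (A0 - {a}) \<noteq> polyh k c A"
    proof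
      assume "polyh k c (A0 - {a}) = polyh k c A"
      then have "P (A0 - {a})" using A0(1) by (auto simp: P_def)
      then have "card A0 \<le> card (A0 - {a})" using A0(2) by blast
      then show False using a fin by (meson card_Diff1_less not_le)
    qed
  qed
qed

text \<open>Dropping a admits a point x where a is negative. The segment from an interior point p to
  x crosses a = 0 at q, where every other constraint is still strict or identically zero; so around
  q the zero set of a in the polyhedron fills its whole hyperplane.\<close>

lemma is_facet_irredundant:
  assumes "finite A" "a \<in> A" "fst (c a) k \<noteq> 0" "core (Suc k) (polyh (Suc k) c A) \<noteq> {}"
    and irr: "polyh (Suc k) c (A - {a}) \<noteq> polyh (Suc k) c A"
  shows "is_facet {x \<in> polyh (Suc k) c A. ev (Suc k) (c a) x = 0} (polyh (Suc k) c A)"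
proof -
  let ?S = "polyh (Suc k) c A" and ?F = "{x \<in> polyh (Suc k) c A. ev (Suc k) (c a) x = 0}"
  let ?V = "{v \<in> rspace (Suc k). lin (Suc k) (c a) v = 0}"
  have S_iff: "x \<in> ?S \<longleftrightarrow> x \<in> polyh (Suc k) c (A - {a}) \<and> 0 \<le> ev (Suc k) (c a) x" for x
    using assms(2) by (auto simp: polyh_def)
  then obtain x where x: "x \<in> polyh (Suc k) c (A - {a})" "ev (Suc k) (c a) x < 0"
    using irr by (metis not_le subsetI subset_antisym)
  obtain p where p: "p \<in> core (Suc k) ?S" using assms by blast
  have p_pos: "0 < ev (Suc k) (c h) p \<or> (\<forall>x\<in>rspace (Suc k). ev (Suc k) (c h) x = 0)" if "h \<in> A" for h
    using p assms(1) that by (simp add: core_polyh)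
  have pa: "0 < ev (Suc k) (c a) p"
    using p_pos[OF assms(2)] ev_not_zero_everywhere[OF assms(3)] by blast
  define u where "u = ev (Suc k) (c a) p / (ev (Suc k) (c a) p - ev (Suc k) (c a) x)"
  have u: "0 < u" "u < 1" "(1 - u) * ev (Suc k) (c a) p + u * ev (Suc k) (c a) x = 0"
    using pa x(2) by (auto simp: u_def field_simps)
  define q where "q = (1 - u) *\<^sub>R p + u *\<^sub>R x"
  have ev_q: "ev (Suc k) (c h) q = (1 - u) * ev (Suc k) (c h) p + u * ev (Suc k) (c h) x" for h
    unfolding q_def by (rule ev_affine) simp
  have q_rspace: "q \<in> rspace (Suc k)"
    using p x by (simp add: q_def core_def polyh_def rspace_add rspace_scaleR)
  have q: "q \<in> core (Suc k) (polyh (Suc k) c (A - {a}))"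
  proof -
    have "0 < ev (Suc k) (c h) q \<or> (\<forall>x\<in>rspace (Suc k). ev (Suc k) (c h) x = 0)" if h: "h \<in> A - {a}" for h
    proof (cases "0 < ev (Suc k) (c h) p")
      case True
      have "0 \<le> ev (Suc k) (c h) x" using x(1) h by (simp add: polyh_def)
      then have "0 < ev (Suc k) (c h) q"
        unfolding ev_q using True u(1,2) by (intro add_pos_nonneg mult_pos_pos mult_nonneg_nonneg) auto
      then show ?thesis by simp
    next
      case False
      then show ?thesis using p_pos h by blast
    qed
    then show ?thesis using assms(1) q_rspace by (simp add: core_polyh)
  qed
  have ev_a_q: "ev (Suc k) (c a) q = 0"
    using u(3) by (simp add: ev_q)
  have "q \<in> ?F"
    using core_subset[OF q] ev_a_q by (simp add: S_iff)
  have "adim ?F = dim ?V"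
  proof (rule adim_eq_dim[OF subspace_lin_zero])
    show "?V \<subseteq> rspace (Suc k)" by blast
    show "x - y \<in> ?V" if "x \<in> ?F" "y \<in> ?F" for x y
      using that polyh_subset_rspace[of "Suc k" c A] by (auto simp: lin_eq_ev_diff intro!: rspace_diff)
    show "q \<in> ?F" by fact
    show "\<exists>e>0. q + e *\<^sub>R v \<in> ?F" if v: "v \<in> ?V" for v
    proof -
      obtain e where e: "e > 0" "q + e *\<^sub>R v \<in> polyh (Suc k) c (A - {a})"
        using q v unfolding core_def by blast
      moreover have "ev (Suc k) (c a) (q + e *\<^sub>R v) = 0"
        using v ev_a_q by (simp add: ev_add_scaleR)
      ultimately show ?thesis by (auto simp: S_iff)
    qed
  qed
  also have "\<dots> = k" using assms(3) by (rule dim_lin_zero)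
  finally have "adim ?F + 1 = adim ?S"
    using adim_of_core[OF assms(4) polyh_subset_rspace] by simp
  moreover have "?F face_of ?S"
    using assms(2) by (rule zero_set_face_of)
  ultimately show ?thesis
    unfolding is_facet_def using \<open>q \<in> ?F\<close> by blast
qed

text \<open>The prism without ceiling and floor is defined by the absence of facets, whereas
  \<open>upd\<close> needs a statement about constraints. In an irredundant description, a
  constraint with nonzero vertical coefficient would cut out an upper or a lower facet, according to
  the sign.\<close>

lemma polyh_vertical_of_no_facets:
  assumes "finite A" "core (Suc k) (polyh (Suc k) c A) \<noteq> {}"
    and up: "\<nexists>F. upper_facet k (polyh (Suc k) c A) F" and low: "\<nexists>G. lower_facet k (polyh (Suc k) c A) G"
  shows "polyh (Suc k) c A = polyh (Suc k) c {h \<in> A. fst (c h) k = 0}"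
proof -
  obtain A0 where A0: "A0 \<subseteq> A" "polyh (Suc k) c A0 = polyh (Suc k) c A"
    "\<And>a. a \<in> A0 \<Longrightarrow> polyh (Suc k) c (A0 - {a}) \<noteq> polyh (Suc k) c A"
    using irredundant_subset[OF assms(1)] by blast
  have fin: "finite A0" using A0(1) assms(1) by (rule finite_subset)
  have "fst (c a) k = 0" if a: "a \<in> A0" for a
  proof (rule ccontr)
    assume nz: "fst (c a) k \<noteq> 0"
    let ?F = "{x \<in> polyh (Suc k) c A. ev (Suc k) (c a) x = 0}"
    have facet: "is_facet ?F (polyh (Suc k) c A)"
      using is_facet_irredundant[of A0 a c k] fin a nz assms(2) A0(2) A0(3)[OF a] by simp
    have aA: "a \<in> A" using a A0(1) by blast
    have "p + t *\<^sub>R unitv k \<notin> polyh (Suc k) c A" if "p \<in> ?F" "t * fst (c a) k < 0" for p t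
    proof -
      have "ev (Suc k) (c a) (p + t *\<^sub>R unitv k) < 0"
        using that by (simp add: ev_Suc_add_unitv)
      then show ?thesis using aA unfolding polyh_def by force
    qed
    note out = this
    show False
    proof (cases "fst (c a) k < 0")
      case True
      then have "upper_facet k (polyh (Suc k) c A) ?F"
        unfolding upper_facet_def using facet out by (blast intro: mult_pos_neg)
      then show False using up by blast
    next
      case False
      have "p - t *\<^sub>R unitv k \<notin> polyh (Suc k) c A" if "p \<in> ?F" "t > 0" for p t
        using out[of p "- t"] that False nz by (simp add: mult_neg_pos)
      then have "lower_facet k (polyh (Suc k) c A) ?F"
        unfolding lower_facet_def using facet by blast
      then show False using low by blast
    qed
  qed
  then have "polyh (Suc k) c {h \<in> A. fst (c h) k = 0} \<subseteq> polyh (Suc k) c A0"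
    using A0(1) by (intro polyh_anti_mono) blast
  moreover have "polyh (Suc k) c A \<subseteq> polyh (Suc k) c {h \<in> A. fst (c h) k = 0}"
    by (intro polyh_anti_mono) blast
  ultimately show ?thesis using A0(2) by blast
qed

lemma linear_vproj: "linear (vproj k)"
  by (rule linearI) (auto simp: vproj_def fun_eq_iff scaleR_fun_def)

lemma facet_zero_set:
  assumes "finite A" "is_facet F (polyh (Suc k) c A)" "core k (vproj k ` F) \<noteq> {}"
    and "\<forall>p\<in>F. \<forall>t>0. p + t *\<^sub>R (\<sigma> *\<^sub>R unitv k) \<notin> polyh (Suc k) c A"
  shows "\<exists>a\<in>A. \<sigma> * fst (c a) k < 0 \<and> F = {x \<in> polyh (Suc k) c A. ev (Suc k) (c a) x = 0}"
proof -
  have face: "F face_of polyh (Suc k) c A" and "F \<noteq> {}"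
    using assms(2) by (auto simp: is_facet_def)
  then obtain a where a: "a \<in> A" "\<sigma> * fst (c a) k < 0" "\<forall>p\<in>F. ev (Suc k) (c a) p = 0"
    using vertical_facet_constraint[OF assms(1), of F k c \<sigma>] assms(4) face_of_imp_convex face_of_imp_subset
    by blast
  have "F = {x \<in> polyh (Suc k) c A. ev (Suc k) (c a) x = 0}"
    using a(2) by (intro face_eq_of_core[OF face _ a(3) assms(3)]) auto
  then show ?thesis using a by blast
qed

lemma upper_facet_zero_set:
  assumes "finite A" "upper_facet k (polyh (Suc k) c A) F" "core k (vproj k ` F) \<noteq> {}"
  shows "\<exists>a\<in>A. fst (c a) k < 0 \<and> F = {x \<in> polyh (Suc k) c A. ev (Suc k) (c a) x = 0}"
  using facet_zero_set[of A F k c 1] assms by (simp add: upper_facet_def)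

lemma lower_facet_zero_set:
  assumes "finite A" "lower_facet k (polyh (Suc k) c A) F" "core k (vproj k ` F) \<noteq> {}"
  shows "\<exists>a\<in>A. fst (c a) k > 0 \<and> F = {x \<in> polyh (Suc k) c A. ev (Suc k) (c a) x = 0}"
  using facet_zero_set[of A F k c "-1"] assms by (simp add: lower_facet_def)

definition facet_pair :: "nat \<Rightarrow> ('l \<Rightarrow> vec \<times> real) \<Rightarrow> 'l set \<Rightarrow> 'l option \<times> 'l option \<Rightarrow> vec set option \<times> vec set option" where
  "facet_pair k c A = map_prod
     (map_option (\<lambda>a. {x \<in> polyh (Suc k) c A. ev (Suc k) (c a) x = 0}))
     (map_option (\<lambda>a. {x \<in> polyh (Suc k) c A. ev (Suc k) (c a) x = 0}))"

text \<open>Passes from prisms indexed by facets to prisms indexed by labels. Several labels may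
  describe one facet, but a label determines its pair of facets, so distinct prisms of one
  polyhedron get distinct labels. The nonempty core qualifies the base for the next family.\<close>

lemma vd_pairs_label:
  assumes "finite A" "core (Suc k) (polyh (Suc k) c A) \<noteq> {}" "p \<in> vd_pairs k (polyh (Suc k) c A)"
  shows "\<exists>q. admissible k c A q \<and> p = facet_pair k c A q
    \<and> vd_base k (polyh (Suc k) c A) p = polyh k (upd k c q) A \<and> core k (polyh k (upd k c q) A) \<noteq> {}"
proof -
  let ?S = "polyh (Suc k) c A"
  let ?Z = "\<lambda>a. {x \<in> polyh (Suc k) c A. ev (Suc k) (c a) x = 0}"
  have facet_convex: "convex (vproj k ` F)" if "is_facet F ?S" for F
    using that face_of_imp_convex by (intro convex_linear_image linear_vproj) (auto simp: is_facet_def)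
  have core: "core k X \<noteq> {}" if "convex X" "X \<subseteq> rspace k" "X = vd_base k ?S p" for X
    using that assms(3) by (intro core_nonempty_of_adim) (auto simp: vd_pairs_def)
  have sub: "vproj k ` F \<subseteq> rspace k" for F
    using vproj_in_rspace by blast
  obtain oF oG where p: "p = (oF, oG)" by force
  show ?thesis
  proof (cases oF)
    case None
    show ?thesis
    proof (cases oG)
      case (Some G)
      with None p have p: "p = (None, Some G)" by simp
      then have G: "lower_facet k ?S G" and base: "vd_base k ?S p = vproj k ` G"
        using assms(3) by (auto simp: vd_pairs_def vd_base_def)
      have ne: "core k (vproj k ` G) \<noteq> {}"
        using G base facet_convex sub by (intro core) (auto simp: lower_facet_def)
      obtain b where b: "b \<in> A" "fst (c b) k > 0" "G = ?Z b"
        using lower_facet_zero_set[OF assms(1) G ne] by blast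
      have "vproj k ` G = polyh k (upd k c (None, Some b)) A"
        using vproj_facet[of c b k A] b by simp
      then show ?thesis
        using b p base ne by (intro exI[of _ "(None, Some b)"]) (auto simp: admissible_def facet_pair_def)
    next
      case None
      with \<open>oF = None\<close> p have p: "p = (None, None)" by simp
      then have base: "vd_base k ?S p = vproj k ` ?S"
        by (simp add: vd_base_def)
      have vert: "?S = polyh (Suc k) c {h \<in> A. fst (c h) k = 0}"
        using assms p by (intro polyh_vertical_of_no_facets) (auto simp: vd_pairs_def)
      have "core k (vproj k ` ?S) \<noteq> {}"
        using base by (intro core sub convex_linear_image linear_vproj convex_polyh) auto
      then show ?thesis
        using vert p base vproj_vertical_polyh[OF vert]
        by (intro exI[of _ "(None, None)"]) (auto simp: admissible_def facet_pair_def)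
    qed
  next
    case (Some F)
    show ?thesis
    proof (cases oG)
      case None
      with Some p have p: "p = (Some F, None)" by simp
      then have F: "upper_facet k ?S F" and base: "vd_base k ?S p = vproj k ` F"
        using assms(3) by (auto simp: vd_pairs_def vd_base_def)
      have ne: "core k (vproj k ` F) \<noteq> {}"
        using F base facet_convex sub by (intro core) (auto simp: upper_facet_def)
      obtain a where a: "a \<in> A" "fst (c a) k < 0" "F = ?Z a"
        using upper_facet_zero_set[OF assms(1) F ne] by blast
      have "vproj k ` F = polyh k (upd k c (Some a, None)) A"
        using vproj_facet[of c a k A] a by simp
      then show ?thesis
        using a p base ne by (intro exI[of _ "(Some a, None)"]) (auto simp: admissible_def facet_pair_def)
    next
      case (Some G)
      with \<open>oF = Some F\<close> p have p: "p = (Some F, Some G)" by simp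
      then have F: "upper_facet k ?S F" and G: "lower_facet k ?S G"
        and base: "vd_base k ?S p = vproj k ` F \<inter> vproj k ` G"
        using assms(3) by (auto simp: vd_pairs_def vd_base_def)
      have ne: "core k (vproj k ` F \<inter> vproj k ` G) \<noteq> {}"
        using F G base facet_convex
        by (intro core convex_Int le_infI1 sub) (auto simp: upper_facet_def lower_facet_def)
      have neF: "core k (vproj k ` F) \<noteq> {}" and neG: "core k (vproj k ` G) \<noteq> {}"
        using ne core_mono[of "vproj k ` F \<inter> vproj k ` G"] by blast+
      obtain a where a: "a \<in> A" "fst (c a) k < 0" "F = ?Z a"
        using upper_facet_zero_set[OF assms(1) F neF] by blast
      obtain b where b: "b \<in> A" "fst (c b) k > 0" "G = ?Z b"
        using lower_facet_zero_set[OF assms(1) G neG] by blast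
      have "vproj k ` F \<inter> vproj k ` G = polyh k (upd k c (Some a, Some b)) A"
        using vproj_facet[of c a k A] vproj_facet[of c b k A] polyh_Int_elim[of a A b c k] a b by simp
      then show ?thesis
        using a b p base ne by (intro exI[of _ "(Some a, Some b)"]) (auto simp: admissible_def facet_pair_def)
    qed
  qed
qed

section \<open>Comparison of dimension 1 with the recursion\<close>

lemma rspace_0: "rspace 0 = {0}"
  by (auto simp: rspace_def fun_eq_iff)

text \<open>Every nonempty set projects onto the one point of R^0, so any choice of an existing
  ceiling and floor is a valid pair.\<close>

lemma vd_pairs_0_nonempty:
  assumes "S \<noteq> {}"
  shows "vd_pairs 0 S \<noteq> {}"
proof -
  have zero: "vproj 0 ` X = {0}" if "X \<noteq> {}" for X
    using that vproj_in_rspace[of 0] by (auto simp: rspace_0)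
  have "adim {0::vec} \<le> dim (rspace 0)"
    unfolding adim_def by (intro dim_mono_rspace[of _ _ 0]) (auto simp: rspace_0)
  then have dim0: "adim {0::vec} = 0" by (simp add: dim_rspace)
  have ne: "X \<noteq> {}" if "upper_facet 0 S X \<or> lower_facet 0 S X" for X
    using that by (auto simp: upper_facet_def lower_facet_def is_facet_def)
  define p where "p = (if \<exists>F. upper_facet 0 S F then Some (SOME F. upper_facet 0 S F) else None,
    if \<exists>F. lower_facet 0 S F then Some (SOME F. lower_facet 0 S F) else None)"
  have "p \<in> vd_pairs 0 S"
    using assms ne someI_ex[of "upper_facet 0 S"] someI_ex[of "lower_facet 0 S"]
    by (auto simp: p_def vd_pairs_def vd_base_def zero dim0)
  then show ?thesis by blast
qed

text \<open>In dimension 1 \<open>vd\<close> is 1 by definition and not by the recursion; being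
  dominated by the recursion, it allows an induction that starts at dimension 0 and has a single
  kind of step.\<close>

lemma vd_Suc_le:
  assumes "finite (vd_pairs k S)" "S \<noteq> {}"
  shows "vd (Suc k) S \<le> (\<Sum>p\<in>vd_pairs k S. vd k (vd_base k S p))"
proof (cases "k = 0")
  case True
  then have "1 \<le> card (vd_pairs k S)"
    using assms vd_pairs_0_nonempty[of S] by (simp add: Suc_le_eq card_gt_0_iff)
  then show ?thesis using True by simp
qed simp

section \<open>Families of polyhedra with disjoint interiors\<close>

lemma mult_Suc_le_square:
  fixes u w N :: nat
  assumes "u + w \<le> 2 * N"
  shows "(u + 1) * (w + 1) \<le> (N + 1) ^ 2"
proof -
  have "4 * ((int u + 1) * (int w + 1)) = (int u + int w + 2)\<^sup>2 - (int u - int w)\<^sup>2"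
    by (simp add: power2_eq_square algebra_simps)
  also have "\<dots> \<le> (int u + int w + 2)\<^sup>2" by simp
  also have "\<dots> \<le> (2 * int N + 2)\<^sup>2"
    using assms by (intro power_mono) auto
  also have "\<dots> = 4 * (int N + 1)\<^sup>2" by (simp add: power2_eq_square algebra_simps)
  finally have "(int u + 1) * (int w + 1) \<le> (int N + 1)\<^sup>2" by linarith
  then have "int ((u + 1) * (w + 1)) \<le> int ((N + 1) ^ 2)"
    by (simp only: of_nat_mult of_nat_add of_nat_1 of_nat_power)
  then show ?thesis by (simp only: of_nat_le_iff)
qed

text \<open>In the induction the functionals c and the index set X vary while L, N and A stay fixed.
  Hence \<open>upd\<close> must act on functionals only: the bases with one label are again a family
  of polyhedra over the same sets of labels.\<close>

lemma sum_vd_polyh_le: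
  assumes "finite L" "card L \<le> 2 * N" "finite X" "\<And>x. x \<in> X \<Longrightarrow> A x \<subseteq> L"
    "\<And>x. x \<in> X \<Longrightarrow> core k (polyh k c (A x)) \<noteq> {}"
    "\<And>x y. x \<in> X \<Longrightarrow> y \<in> X \<Longrightarrow> x \<noteq> y \<Longrightarrow> core k (polyh k c (A x)) \<inter> core k (polyh k c (A y)) = {}"
  shows "(\<Sum>x\<in>X. vd k (polyh k c (A x))) \<le> (N + 1) ^ (2 * k)"
  using assms(3-6)
proof (induction k arbitrary: X c)
  case 0
  \<comment> \<open>A nonempty core in R^0 contains 0, so two members would meet there.\<close>
  have "0 \<in> core 0 (polyh 0 c (A x))" if "x \<in> X" for x
    using 0(3)[OF that] by (auto simp: core_def rspace_0)
  then have "x = y" if "x \<in> X" "y \<in> X" for x y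
    using 0(4)[OF that] that by blast
  then have "card X \<le> 1"
    using 0(1) by (simp add: card_le_Suc0_iff_eq)
  then show ?case by simp
next
  case (Suc k)
  define S where "S x = polyh (Suc k) c (A x)" for x
  define U where "U = {a \<in> L. fst (c a) k < 0}"
  define W where "W = {a \<in> L. fst (c a) k > 0}"
  define Q where "Q = insert None (Some ` U) \<times> insert None (Some ` W)"
  have finA: "finite (A x)" if "x \<in> X" for x
    using Suc.prems(2)[OF that] assms(1) by (rule finite_subset)
  have finUW: "finite U" "finite W" using assms(1) by (auto simp: U_def W_def)
  then have finQ: "finite Q" by (auto simp: Q_def)
  define R where "R x p q \<longleftrightarrow> admissible k c (A x) q \<and> p = facet_pair k c (A x) q
    \<and> vd_base k (S x) p = polyh k (upd k c q) (A x) \<and> core k (polyh k (upd k c q) (A x)) \<noteq> {}" for x p q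
  define lab where "lab x p = (SOME q. R x p q)" for x p
  have lab: "R x p (lab x p)" if "x \<in> X" "p \<in> vd_pairs k (S x)" for x p
  proof -
    have "\<exists>q. R x p q"
      using vd_pairs_label[OF finA[OF that(1)] Suc.prems(3)[OF that(1)], of p] that(2)
      unfolding R_def S_def by blast
    then show ?thesis unfolding lab_def by (rule someI_ex)
  qed
  have labQ: "lab x p \<in> Q" if "x \<in> X" "p \<in> vd_pairs k (S x)" for x p
  proof -
    have "admissible k c (A x) (lab x p)" using lab[OF that] by (simp add: R_def)
    then show ?thesis
      using Suc.prems(2)[OF that(1)]
      by (cases "lab x p"; cases "fst (lab x p)"; cases "snd (lab x p)")
        (auto simp: admissible_def Q_def U_def W_def)
  qed
  \<comment> \<open>An infinite sum would be 0 and break the comparison with the recursion; the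
    finitely many labels exclude this.\<close>
  have finVP: "finite (vd_pairs k (S x))" if "x \<in> X" for x
  proof (rule finite_subset)
    show "vd_pairs k (S x) \<subseteq> facet_pair k c (A x) ` Q"
    proof
      fix p assume p: "p \<in> vd_pairs k (S x)"
      then have "p = facet_pair k c (A x) (lab x p)"
        using lab[OF that p] by (simp add: R_def)
      then show "p \<in> facet_pair k c (A x) ` Q"
        using labQ[OF that p] by (rule image_eqI)
    qed
  qed (use finQ in blast)
  define T where "T = (SIGMA x:X. vd_pairs k (S x))"
  have finT: "finite T" using Suc.prems(1) finVP by (auto simp: T_def)
  define g where "g t = vd k (vd_base k (S (fst t)) (snd t))" for t
  define l where "l t = lab (fst t) (snd t)" for t
  have "(\<Sum>x\<in>X. vd (Suc k) (S x)) \<le> (\<Sum>x\<in>X. \<Sum>p\<in>vd_pairs k (S x). vd k (vd_base k (S x) p))"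
  proof (intro sum_mono vd_Suc_le finVP)
    show "S x \<noteq> {}" if "x \<in> X" for x
      using Suc.prems(3)[OF that] core_subset unfolding S_def by blast
  qed
  also have "\<dots> = (\<Sum>t\<in>T. g t)"
    unfolding T_def g_def using Suc.prems(1) finVP by (subst sum.Sigma) (auto simp: case_prod_unfold)
  also have "\<dots> = (\<Sum>q\<in>Q. sum g {t \<in> T. l t = q})"
    using finT finQ labQ by (intro sum.group[symmetric]) (auto simp: l_def T_def)
  also have "\<dots> \<le> (\<Sum>q\<in>Q. (N + 1) ^ (2 * k))"
  proof (rule sum_mono)
    fix q assume "q \<in> Q"
    define Tq where "Tq = {t \<in> T. l t = q}"
    have Tq: "fst t \<in> X \<and> snd t \<in> vd_pairs k (S (fst t)) \<and> lab (fst t) (snd t) = q" if "t \<in> Tq" for t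
      using that by (auto simp: Tq_def T_def l_def)
    have props: "admissible k c (A (fst t)) q" "snd t = facet_pair k c (A (fst t)) q"
      "g t = vd k (polyh k (upd k c q) (A (fst t)))" "core k (polyh k (upd k c q) (A (fst t))) \<noteq> {}"
      if "t \<in> Tq" for t
      using lab[of "fst t" "snd t"] Tq[OF that] by (auto simp: g_def R_def)
    \<comment> \<open>Polyhedron and label together determine the prism, so a class contains at most
      one base per polyhedron and can be indexed by polyhedra again.\<close>
    have inj: "inj_on fst Tq"
    proof (rule inj_onI)
      fix s t assume st: "s \<in> Tq" "t \<in> Tq" "fst s = fst t"
      then have "snd s = snd t" using props(2)[OF st(1)] props(2)[OF st(2)] by simp
      with st(3) show "s = t" by (rule prod_eqI)
    qed
    have "sum g Tq = (\<Sum>x\<in>fst ` Tq. vd k (polyh k (upd k c q) (A x)))"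
      using inj props(3) by (simp add: sum.reindex)
    also have "\<dots> \<le> (N + 1) ^ (2 * k)"
    proof (rule Suc.IH)
      show "finite (fst ` Tq)" using finT by (simp add: Tq_def)
      show "A x \<subseteq> L" if "x \<in> fst ` Tq" for x
        using that Tq Suc.prems(2) by blast
      show "core k (polyh k (upd k c q) (A x)) \<noteq> {}" if "x \<in> fst ` Tq" for x
        using that props(4) by blast
      show "core k (polyh k (upd k c q) (A x)) \<inter> core k (polyh k (upd k c q) (A y)) = {}"
        if "x \<in> fst ` Tq" "y \<in> fst ` Tq" "x \<noteq> y" for x y
      proof (rule ccontr)
        assume "core k (polyh k (upd k c q) (A x)) \<inter> core k (polyh k (upd k c q) (A y)) \<noteq> {}"
        then obtain z where z: "z \<in> core k (polyh k (upd k c q) (A x))" "z \<in> core k (polyh k (upd k c q) (A y))"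
          by blast
        have X: "x \<in> X" "y \<in> X" using that Tq by blast+
        have adm: "admissible k c (A x) q" "admissible k c (A y) q" using that props(1) by blast+
        show False
          using core_lift[OF finA[OF X(1)] finA[OF X(2)] adm Suc.prems(3)[OF X(1)] Suc.prems(3)[OF X(2)] z]
            Suc.prems(4)[OF X that(3)] by blast
      qed
    qed
    finally show "sum g {t \<in> T. l t = q} \<le> (N + 1) ^ (2 * k)"
      by (simp add: Tq_def)
  qed
  also have "\<dots> = card Q * (N + 1) ^ (2 * k)" by simp
  also have "\<dots> \<le> (N + 1) ^ 2 * (N + 1) ^ (2 * k)"
  proof (rule mult_right_mono)
    have "card U + card W = card (U \<union> W)"
      using finUW by (subst card_Un_disjoint) (auto simp: U_def W_def)
    also have "\<dots> \<le> card L" using assms(1) by (intro card_mono) (auto simp: U_def W_def)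
    finally have "card U + card W \<le> 2 * N" using assms(2) by simp
    then have "(card U + 1) * (card W + 1) \<le> (N + 1) ^ 2" by (rule mult_Suc_le_square)
    moreover have "card Q = (card U + 1) * (card W + 1)"
      unfolding Q_def card_cartesian_product using finUW by (simp add: card_image image_iff)
    ultimately show "card Q \<le> (N + 1) ^ 2" by simp
  qed simp
  also have "\<dots> = (N + 1) ^ (2 * Suc k)" by (simp flip: power_add)
  finally show ?case by (simp add: S_def)
qed

section \<open>Cells of an arrangement\<close>

lemma linear_lin: "linear (lin k f)"
  by (rule linearI) (simp_all add: lin_add lin_scaleR)

definition signed :: "('h \<Rightarrow> vec \<times> real) \<Rightarrow> 'h \<times> bool \<Rightarrow> vec \<times> real" where
  "signed f l = (if snd l then f (fst l) else (\<lambda>i. - fst (f (fst l)) i, - snd (f (fst l))))"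

lemma ev_signed: "ev k (signed f (h, s)) x = (if s then ev k (f h) x else - ev k (f h) x)"
  by (simp add: signed_def ev_def lin_def sum_negf)

definition pullback :: "nat \<Rightarrow> vec \<Rightarrow> (vec \<Rightarrow> vec) \<Rightarrow> vec \<times> real \<Rightarrow> vec \<times> real" where
  "pullback d c L f = (\<lambda>i. lin d f (L (unitv i)), ev d f c)"

lemma ev_pullback:
  assumes "linear L" "y \<in> rspace j"
  shows "ev j (pullback d c L f) y = ev d f (c + L y)"
proof -
  have "linear (\<lambda>v. lin d f (L v))"
    using linear_compose[OF assms(1) linear_lin] by (simp add: o_def)
  then have "(\<Sum>i<j. lin d f (L (y i *\<^sub>R unitv i))) = lin d f (L (\<Sum>i<j. y i *\<^sub>R unitv i))"
    by (rule linear_sum[symmetric])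
  also have "\<dots> = lin d f (L y)"
    by (simp only: vec_eq_sum_unitv[OF assms(2), symmetric])
  finally have "lin j (pullback d c L f) y = lin d f (L y)"
    by (simp add: lin_def[of j] pullback_def linear_scale[OF assms(1)] lin_scaleR mult.commute)
  then show ?thesis
    by (simp add: ev_def lin_add pullback_def)
qed

lemma continuous_on_ev: "continuous_on UNIV (ev k f)"
  unfolding ev_def lin_def by (intro continuous_intros) simp

lemma closed_polyh: "closed (polyh k c A)"
proof -
  have "closed {x::vec. x i = 0}" for i
    by (intro closed_Collect_eq continuous_intros) simp
  then have "closed (\<Inter>i\<in>{k..}. {x::vec. x i = 0})" by blast
  moreover have "closed {x. 0 \<le> ev k (c h) x}" for h
    by (intro closed_Collect_le continuous_on_ev continuous_intros)
  then have "closed (\<Inter>h\<in>A. {x. 0 \<le> ev k (c h) x})" by blast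
  moreover have "polyh k c A = (\<Inter>i\<in>{k..}. {x. x i = 0}) \<inter> (\<Inter>h\<in>A. {x. 0 \<le> ev k (c h) x})"
    by (auto simp: polyh_def rspace_def)
  ultimately show ?thesis by (simp add: closed_Int)
qed

text \<open>Turns the separation of points by h into a comparison of signs: an affine function with
  opposite signs at the ends of a segment vanishes at the point with parameter u, and with equal
  nonzero signs it vanishes nowhere on it.\<close>

lemma sgn_ev_iff_segment:
  assumes "x \<in> rspace d" "y \<in> rspace d" and h_def: "h = {z \<in> rspace d. ev d f z = 0}"
  shows "(y \<in> h \<longleftrightarrow> x \<in> h) \<and> (x \<notin> h \<longrightarrow> closed_segment x y \<inter> h = {}) \<longleftrightarrow> sgn (ev d f y) = sgn (ev d f x)"
proof
  assume *: "(y \<in> h \<longleftrightarrow> x \<in> h) \<and> (x \<notin> h \<longrightarrow> closed_segment x y \<inter> h = {})"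
  show "sgn (ev d f y) = sgn (ev d f x)"
  proof (cases "ev d f x = 0")
    case True
    then show ?thesis using * assms by auto
  next
    case False
    then have nz: "ev d f y \<noteq> 0" and disj: "closed_segment x y \<inter> h = {}"
      using * assms by auto
    show ?thesis
    proof (rule ccontr)
      assume neq: "sgn (ev d f y) \<noteq> sgn (ev d f x)"
      define u where "u = ev d f x / (ev d f x - ev d f y)"
      have opp: "ev d f x > 0 \<and> ev d f y < 0 \<or> ev d f x < 0 \<and> ev d f y > 0"
        using False nz neq by (auto simp: sgn_if split: if_splits)
      then have u: "0 \<le> u" "u \<le> 1" "(1 - u) * ev d f x + u * ev d f y = 0"
        by (auto simp: u_def field_simps)
      define z where "z = (1 - u) *\<^sub>R x + u *\<^sub>R y"
      have "z \<in> closed_segment x y" using u by (auto simp: in_segment z_def)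
      moreover have "ev d f z = 0" using u(3) by (simp add: z_def ev_affine)
      moreover have "z \<in> rspace d" using assms by (simp add: z_def rspace_add rspace_scaleR)
      ultimately show False using disj by (auto simp: h_def)
    qed
  qed
next
  assume *: "sgn (ev d f y) = sgn (ev d f x)"
  then have "ev d f y = 0 \<longleftrightarrow> ev d f x = 0" by (metis sgn_0_0)
  then have "y \<in> h \<longleftrightarrow> x \<in> h" using assms by simp
  moreover have "ev d f z \<noteq> 0" if nz: "ev d f x \<noteq> 0" and z: "z \<in> closed_segment x y" for z
  proof -
    obtain u where u: "0 \<le> u" "u \<le> 1" "z = (1 - u) *\<^sub>R x + u *\<^sub>R y"
      using z unfolding in_segment by blast
    have ev_z: "ev d f z = (1 - u) * ev d f x + u * ev d f y"
      unfolding u(3) by (rule ev_affine) simp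
    consider "ev d f x > 0" "ev d f y > 0" | "ev d f x < 0" "ev d f y < 0"
      using * nz by (auto simp: sgn_if split: if_splits)
    then show ?thesis
    proof cases
      case 1
      then have "0 < ev d f z"
        unfolding ev_z using u by (cases "u = 1") (auto intro: add_pos_nonneg)
      then show ?thesis by simp
    next
      case 2
      then have "ev d f z < 0"
        unfolding ev_z using u by (cases "u = 1") (auto intro!: add_neg_nonpos mult_pos_neg mult_nonneg_nonpos)
      then show ?thesis by simp
    qed
  qed
  then have "x \<notin> h \<longrightarrow> closed_segment x y \<inter> h = {}" using assms(1) by (auto simp: h_def)
  ultimately show "(y \<in> h \<longleftrightarrow> x \<in> h) \<and> (x \<notin> h \<longrightarrow> closed_segment x y \<inter> h = {})" by blast
qed

definition sign_cell :: "nat \<Rightarrow> vec set set \<Rightarrow> (vec set \<Rightarrow> vec \<times> real) \<Rightarrow> vec \<Rightarrow> vec set" where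
  "sign_cell d H f x = {y \<in> rspace d. \<forall>h\<in>H. sgn (ev d (f h) y) = sgn (ev d (f h) x)}"

text \<open>For a cell C, a hyperplane containing C contributes both of its sides, so that an
  equation becomes two inequalities; every other hyperplane contributes exactly one.\<close>

definition sides :: "nat \<Rightarrow> vec set set \<Rightarrow> (vec set \<Rightarrow> vec \<times> real) \<Rightarrow> vec set \<Rightarrow> (vec set \<times> bool) set" where
  "sides d H f C = {l \<in> H \<times> UNIV. \<forall>x\<in>C. 0 \<le> ev d (signed f l) x}"

locale arrangement =
  fixes d :: nat and H :: "vec set set" and f :: "vec set \<Rightarrow> vec \<times> real"
  assumes finite_H: "finite H"
    and hyperplane: "h \<in> H \<Longrightarrow> h = {x \<in> rspace d. ev d (f h) x = 0}"
begin

lemma arr_cells_eq: "arr_cells d H = sign_cell d H f ` rspace d"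
proof -
  have "{y \<in> rspace d. \<forall>h\<in>H. (y \<in> h \<longleftrightarrow> x \<in> h) \<and> (x \<notin> h \<longrightarrow> closed_segment x y \<inter> h = {})}
      = sign_cell d H f x" if x: "x \<in> rspace d" for x
  proof -
    have "(y \<in> h \<longleftrightarrow> x \<in> h) \<and> (x \<notin> h \<longrightarrow> closed_segment x y \<inter> h = {})
      \<longleftrightarrow> sgn (ev d (f h) y) = sgn (ev d (f h) x)" if "h \<in> H" "y \<in> rspace d" for h y
      using sgn_ev_iff_segment[OF x that(2) hyperplane[OF that(1)]] .
    then show ?thesis
      unfolding sign_cell_def by (intro Collect_cong conj_cong ball_cong refl)
  qed
  then show ?thesis
    unfolding arr_cells_def setcompr_eq_image Collect_mem_eq by (rule image_cong[OF refl])
qed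

lemma cell_subset_rspace: "C \<in> arr_cells d H \<Longrightarrow> C \<subseteq> rspace d"
  by (auto simp: arr_cells_eq sign_cell_def)

lemma cell_nonempty: "C \<in> arr_cells d H \<Longrightarrow> \<exists>x. x \<in> C"
  by (auto simp: arr_cells_eq sign_cell_def)

lemma cell_eq_sign_cell:
  assumes "C \<in> arr_cells d H" "x \<in> C"
  shows "C = sign_cell d H f x"
  using assms by (auto simp: arr_cells_eq sign_cell_def)

lemma cell_eq_if_common:
  assumes "C \<in> arr_cells d H" "C' \<in> arr_cells d H" "x \<in> C" "x \<in> C'"
  shows "C = C'"
  using cell_eq_sign_cell assms by metis

lemma sides_of_sgn:
  assumes "C \<in> arr_cells d H" "x \<in> C" "h \<in> H"
  shows "(h, True) \<in> sides d H f C \<longleftrightarrow> 0 \<le> ev d (f h) x"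
    and "(h, False) \<in> sides d H f C \<longleftrightarrow> ev d (f h) x \<le> 0"
proof -
  have "sgn (ev d (f h) y) = sgn (ev d (f h) x)" if "y \<in> C" for y
    using that cell_eq_sign_cell[OF assms(1,2)] assms(3) by (auto simp: sign_cell_def)
  then have sign: "0 \<le> ev d (f h) y \<longleftrightarrow> 0 \<le> ev d (f h) x" "ev d (f h) y \<le> 0 \<longleftrightarrow> ev d (f h) x \<le> 0"
    if "y \<in> C" for y
    using that by (metis zero_le_sgn_iff, metis sgn_le_0_iff)
  have "(h, True) \<in> sides d H f C \<longleftrightarrow> (\<forall>y\<in>C. 0 \<le> ev d (f h) y)"
    "(h, False) \<in> sides d H f C \<longleftrightarrow> (\<forall>y\<in>C. ev d (f h) y \<le> 0)"
    using assms(3) by (simp_all add: sides_def ev_signed)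
  then show "(h, True) \<in> sides d H f C \<longleftrightarrow> 0 \<le> ev d (f h) x"
    "(h, False) \<in> sides d H f C \<longleftrightarrow> ev d (f h) x \<le> 0"
    using sign assms(2) by blast+
qed

text \<open>On the way from a point x of C to a point y satisfying the weak inequalities no sign
  changes before y is reached, so y is a limit of points of C.\<close>

lemma closure_cell:
  assumes C: "C \<in> arr_cells d H"
  shows "closure C = polyh d (signed f) (sides d H f C)"
proof
  have "C \<subseteq> polyh d (signed f) (sides d H f C)"
    using cell_subset_rspace[OF C] by (auto simp: polyh_def sides_def)
  then show "closure C \<subseteq> polyh d (signed f) (sides d H f C)"
    using closed_polyh by (rule closure_minimal)
  obtain x where x: "x \<in> C" using cell_nonempty[OF C] by blast
  show "polyh d (signed f) (sides d H f C) \<subseteq> closure C"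
  proof
    fix y assume y: "y \<in> polyh d (signed f) (sides d H f C)"
    have rs: "x \<in> rspace d" "y \<in> rspace d"
      using x cell_subset_rspace[OF C] y polyh_subset_rspace by blast+
    define w where "w t = (1 - t) *\<^sub>R x + t *\<^sub>R y" for t
    have "w t \<in> C" if t: "t \<in> {0..<1}" for t
    proof -
      have "sgn (ev d (f h) (w t)) = sgn (ev d (f h) x)" if h: "h \<in> H" for h
      proof -
        have ev_w: "ev d (f h) (w t) = (1 - t) * ev d (f h) x + t * ev d (f h) y"
          unfolding w_def by (rule ev_affine) simp
        have y_pos: "0 \<le> ev d (f h) x \<Longrightarrow> 0 \<le> ev d (f h) y"
          and y_neg: "ev d (f h) x \<le> 0 \<Longrightarrow> ev d (f h) y \<le> 0"
          using y sides_of_sgn[OF C x h] by (force simp: polyh_def ev_signed)+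
        consider "ev d (f h) x > 0" | "ev d (f h) x = 0" | "ev d (f h) x < 0" by linarith
        then show ?thesis
        proof cases
          case 1
          then have "0 < ev d (f h) (w t)"
            unfolding ev_w using t y_pos by (intro add_pos_nonneg mult_pos_pos mult_nonneg_nonneg) auto
          then show ?thesis using 1 by simp
        next
          case 2
          then have "ev d (f h) y = 0" using y_pos y_neg by simp
          then show ?thesis using 2 by (simp add: ev_w)
        next
          case 3
          then have "ev d (f h) (w t) < 0"
            unfolding ev_w using t y_neg by (intro add_neg_nonpos mult_pos_neg mult_nonneg_nonpos) auto
          then show ?thesis using 3 by simp
        qed
      qed
      moreover have "w t \<in> rspace d" using rs by (simp add: w_def rspace_add rspace_scaleR)
      ultimately show ?thesis
        using cell_eq_sign_cell[OF C x] by (simp add: sign_cell_def)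
    qed
    then have "w ` {0..<1} \<subseteq> closure C" using closure_subset by blast
    moreover have "continuous_on (closure {0..<1}) w"
      unfolding w_def scaleR_fun_def plus_fun_def
      by (intro continuous_on_coordinatewise_then_product continuous_intros)
    ultimately have "w ` closure {0..<1} \<subseteq> closure C"
      by (intro image_closure_subset) auto
    then have "w 1 \<in> closure C" by auto
    then show "y \<in> closure C" by (simp add: w_def)
  qed
qed

lemma affine_zero_set: "affine {x \<in> rspace d. \<forall>h\<in>G. ev d (f h) x = 0}"
  by (auto simp: affine_def ev_affine rspace_add rspace_scaleR)

text \<open>From x a short move towards any y of the flat stays in C: nonzero signs persist, and the
  hyperplanes through x contain the whole line. Prolonging this move reaches y.\<close>

lemma affine_hull_cell:
  assumes C: "C \<in> arr_cells d H" and x: "x \<in> C"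
  shows "affine hull C = {y \<in> rspace d. \<forall>h\<in>{h \<in> H. ev d (f h) x = 0}. ev d (f h) y = 0}" (is "_ = ?F")
proof
  have Ceq: "C = sign_cell d H f x" using cell_eq_sign_cell[OF C x] .
  have "C \<subseteq> ?F"
    unfolding Ceq sign_cell_def by (auto simp: sgn_0_0)
  then show "affine hull C \<subseteq> ?F"
    by (intro hull_minimal affine_zero_set)
  show "?F \<subseteq> affine hull C"
  proof
    fix y assume y: "y \<in> ?F"
    have rs: "x \<in> rspace d" using x cell_subset_rspace[OF C] by blast
    have "\<forall>\<^sub>F t in at_right 0. sgn (ev d (f h) (x + t *\<^sub>R (y - x))) = sgn (ev d (f h) x)" if h: "h \<in> H" for h
    proof -
      have lim: "((\<lambda>t. ev d (f h) x + t * lin d (f h) (y - x)) \<longlongrightarrow> ev d (f h) x + 0 * lin d (f h) (y - x)) (at_right 0)"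
        by (intro tendsto_intros)
      consider "ev d (f h) x > 0" | "ev d (f h) x = 0" | "ev d (f h) x < 0" by linarith
      then show ?thesis
      proof cases
        case 1
        then have "\<forall>\<^sub>F t in at_right 0. 0 < ev d (f h) x + t * lin d (f h) (y - x)"
          using lim order_tendstoD(1) by fastforce
        then show ?thesis by eventually_elim (use 1 in \<open>simp add: ev_add_scaleR\<close>)
      next
        case 2
        then show ?thesis using y h by (simp add: ev_add_scaleR lin_eq_ev_diff)
      next
        case 3
        then have "\<forall>\<^sub>F t in at_right 0. ev d (f h) x + t * lin d (f h) (y - x) < 0"
          using lim order_tendstoD(2) by fastforce
        then show ?thesis by eventually_elim (use 3 in \<open>simp add: ev_add_scaleR\<close>)
      qed
    qed
    then have "\<forall>\<^sub>F t in at_right 0. \<forall>h\<in>H. sgn (ev d (f h) (x + t *\<^sub>R (y - x))) = sgn (ev d (f h) x)"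
      using finite_H by (simp add: eventually_ball_finite)
    moreover have "\<forall>\<^sub>F t in at_right 0. (0::real) < t"
      by (simp add: eventually_at_right_less)
    ultimately have "\<forall>\<^sub>F t in at_right 0. 0 < t \<and> x + t *\<^sub>R (y - x) \<in> C"
    proof eventually_elim
      case (elim t)
      have "x + t *\<^sub>R (y - x) \<in> rspace d"
        using rs y by (intro rspace_add rspace_scaleR rspace_diff) auto
      then have "x + t *\<^sub>R (y - x) \<in> sign_cell d H f x"
        using elim(1) by (simp add: sign_cell_def)
      then show ?case using elim(2) Ceq by blast
    qed
    then obtain t where t: "0 < t" "x + t *\<^sub>R (y - x) \<in> C"
      using eventually_happens' trivial_limit_at_right_real by blast
    have "(1 - 1/t) *\<^sub>R x + (1/t) *\<^sub>R (x + t *\<^sub>R (y - x)) \<in> affine hull C"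
      using x t(2) by (intro mem_affine affine_affine_hull hull_inc) auto
    moreover have "(1 - 1/t) *\<^sub>R x + (1/t) *\<^sub>R (x + t *\<^sub>R (y - x)) = y"
      using t(1) by (simp add: scaleR_right_distrib scaleR_left_diff_distrib)
    ultimately show "y \<in> affine hull C" by simp
  qed
qed

text \<open>Take G of greatest cardinality satisfying the inequality. If G left more directions than
  H0 does, some hyperplane of H0 would lower the dimension by at least 1, and adding it to G would
  preserve the inequality.\<close>

lemma defining_hyperplanes:
  assumes H0: "H0 \<subseteq> H"
  shows "\<exists>G\<subseteq>H0. {v \<in> rspace d. \<forall>h\<in>G. lin d (f h) v = 0} = {v \<in> rspace d. \<forall>h\<in>H0. lin d (f h) v = 0}
    \<and> card G + dim {v \<in> rspace d. \<forall>h\<in>G. lin d (f h) v = 0} \<le> d"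
proof -
  define V where "V G = {v \<in> rspace d. \<forall>h\<in>G. lin d (f h) v = 0}" for G
  have subV: "subspace (V G)" for G
    by (simp add: V_def subspace_def rspace_zero rspace_add rspace_scaleR lin_zero lin_add lin_scaleR)
  have finH0: "finite H0" using H0 finite_H by (rule finite_subset)
  define P where "P G \<longleftrightarrow> G \<subseteq> H0 \<and> card G + dim (V G) \<le> d" for G
  have "P {}" by (simp add: P_def V_def dim_rspace)
  moreover have "\<forall>G. P G \<longrightarrow> card G < Suc (card H0)"
    using finH0 by (auto simp: P_def less_Suc_eq_le intro: card_mono)
  ultimately obtain G where G: "P G" "\<forall>G'. P G' \<longrightarrow> card G' \<le> card G"
    using ex_has_greatest_nat[of P "{}" card "Suc (card H0)"] by blast
  have "V G = V H0"
  proof (rule ccontr)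
    assume "V G \<noteq> V H0"
    moreover have "V H0 \<subseteq> V G" using G(1) by (auto simp: V_def P_def)
    ultimately obtain v where v: "v \<in> V G" "v \<notin> V H0" by blast
    then obtain h where h: "h \<in> H0" "lin d (f h) v \<noteq> 0" by (auto simp: V_def)
    then have "h \<notin> G" using v by (auto simp: V_def)
    have "V (insert h G) \<subset> V G" using v h by (auto simp: V_def)
    then have "dim (V (insert h G)) < dim (V G)"
      by (rule dim_less_rspace[OF subV subV]) (auto simp: V_def)
    moreover have "finite G" using G(1) finH0 by (auto simp: P_def dest: finite_subset)
    ultimately have "P (insert h G)" using G(1) h \<open>h \<notin> G\<close> by (simp add: P_def)
    then have "card (insert h G) \<le> card G" using G(2) by blast
    then show False using \<open>h \<notin> G\<close> \<open>finite G\<close> by simp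
  qed
  then show ?thesis using G(1) unfolding P_def V_def by blast
qed

lemma affine_hull_cell_defining:
  assumes C: "C \<in> arr_cells d H"
  shows "\<exists>G\<subseteq>H. affine hull C = {y \<in> rspace d. \<forall>h\<in>G. ev d (f h) y = 0} \<and> card G + adim C \<le> d"
proof -
  obtain x where x: "x \<in> C" using cell_nonempty[OF C] by blast
  have xr: "x \<in> rspace d" using x cell_subset_rspace[OF C] by blast
  define H0 where "H0 = {h \<in> H. ev d (f h) x = 0}"
  define V where "V G = {v \<in> rspace d. \<forall>h\<in>G. lin d (f h) v = 0}" for G
  obtain G where G: "G \<subseteq> H0" "V G = V H0" "card G + dim (V G) \<le> d"
    using defining_hyperplanes[of H0] unfolding V_def H0_def by blast
  have zero_iff: "y \<in> {y \<in> rspace d. \<forall>h\<in>B. ev d (f h) y = 0} \<longleftrightarrow> y \<in> rspace d \<and> y - x \<in> V B"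
    if "B \<subseteq> H0" for B y
    using that xr by (auto simp: V_def H0_def lin_eq_ev_diff rspace_diff subset_iff)
  have hull: "affine hull C = {y \<in> rspace d. \<forall>h\<in>H0. ev d (f h) y = 0}"
    using affine_hull_cell[OF C x] by (simp add: H0_def)
  then have "affine hull C = {y \<in> rspace d. \<forall>h\<in>G. ev d (f h) y = 0}"
    using zero_iff[OF G(1)] zero_iff[OF order_refl] G(2) by auto
  moreover have "adim C \<le> dim (V H0)"
    unfolding adim_def
  proof (rule dim_mono_rspace)
    show "V H0 \<subseteq> rspace d" by (auto simp: V_def)
    have "C \<subseteq> affine hull C" by (rule hull_subset)
    then show "{x - y |x y. x \<in> C \<and> y \<in> C} \<subseteq> V H0"
      unfolding hull by (fastforce simp: V_def lin_eq_ev_diff subset_iff intro!: rspace_diff)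
  qed
  ultimately show ?thesis
    using G by (intro exI[of _ G]) (auto simp: H0_def)
qed

lemma affine_hull_full_cell:
  assumes "C \<in> arr_cells d H" "adim C = d"
  shows "affine hull C = rspace d"
proof -
  obtain G where G: "G \<subseteq> H" "affine hull C = {y \<in> rspace d. \<forall>h\<in>G. ev d (f h) y = 0}" "card G + adim C \<le> d"
    using affine_hull_cell_defining[OF assms(1)] by blast
  have "finite G" using G(1) finite_H by (rule finite_subset)
  then have "G = {}" using G(3) assms(2) by simp
  then show ?thesis using G(2) by simp
qed

text \<open>In the coordinates y the closures of these cells are polyhedra over one set of two
  labels per hyperplane. Their interiors are disjoint because they are mapped into the relatively
  open cells.\<close>

lemma sum_vd_cells_in_flat:
  assumes X: "X \<subseteq> arr_cells d H" "finite X" and F: "\<And>C. C \<in> X \<Longrightarrow> affine hull C = F"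
    and L: "linear L" "bij_betw (\<lambda>y. c + L y) (rspace j) F"
  shows "(\<Sum>C\<in>X. vd j {y \<in> rspace j. c + L y \<in> closure C}) \<le> (card H + 1) ^ (2 * j)"
proof -
  define g where "g l = pullback d c L (signed f l)" for l
  have ev_g: "ev j (g (h, s)) y = (if s then ev d (f h) (c + L y) else - ev d (f h) (c + L y))"
    if "y \<in> rspace j" for h s y
    unfolding g_def ev_pullback[OF L(1) that] by (rule ev_signed)
  have fin: "finite (sides d H f C)" for C
    using finite_H by (auto simp: sides_def intro: finite_subset[of _ "H \<times> UNIV"])
  have F_rspace: "F \<subseteq> rspace d" if "C \<in> X" for C
    using F[OF that] affine_hull_cell_defining[of C] that X(1) by blast
  have polyh_eq: "{y \<in> rspace j. c + L y \<in> closure C} = polyh j g (sides d H f C)" if C: "C \<in> X" for C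
  proof -
    have "c + L y \<in> rspace d" if "y \<in> rspace j" for y
      using that bij_betwE[OF L(2)] F_rspace[OF C] by blast
    then show ?thesis
      using closure_cell[of C] C X(1)
      by (auto simp: polyh_def g_def ev_pullback[OF L(1)])
  qed
  have param: "\<exists>y0\<in>rspace j. c + L y0 \<in> C" if C: "C \<in> X" for C
  proof -
    obtain x where x: "x \<in> C" using cell_nonempty C X(1) by blast
    then have "x \<in> F" using F[OF C] by (metis hull_inc)
    then have "x \<in> (\<lambda>y. c + L y) ` rspace j" using L(2) by (simp add: bij_betw_def)
    then show ?thesis using x by blast
  qed
  have zero: "ev d (f h) (c + L y) = 0"
    if "C \<in> X" "h \<in> H" "x \<in> C" "ev d (f h) x = 0" "y \<in> rspace j" for C h x y
  proof -
    have "c + L y \<in> affine hull C" using bij_betwE[OF L(2)] that(5) F[OF that(1)] by blast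
    moreover have "C \<in> arr_cells d H" using that(1) X(1) by blast
    ultimately show ?thesis
      using affine_hull_cell[OF _ that(3)] that(2,4) by blast
  qed
  \<comment> \<open>In the interior every constraint that is not identically zero on the flat is
    strict, so z yields the same signs as the point \<open>y0\<close> of the cell.\<close>
  have core_in_cell: "c + L z \<in> C" if C: "C \<in> X" and z: "z \<in> core j (polyh j g (sides d H f C))" for C z
  proof -
    obtain y0 where y0: "y0 \<in> rspace j" "c + L y0 \<in> C" using param[OF C] by blast
    have Cc: "C \<in> arr_cells d H" using C X(1) by blast
    have zr: "z \<in> rspace j" using z by (simp add: core_def)
    have pos: "0 < ev j (g l) z" if "l \<in> sides d H f C" "ev j (g l) y0 \<noteq> 0" for l
      using z fin that y0(1) by (auto simp: core_polyh)
    have "sgn (ev d (f h) (c + L z)) = sgn (ev d (f h) (c + L y0))" if h: "h \<in> H" for h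
    proof -
      consider "ev d (f h) (c + L y0) > 0" | "ev d (f h) (c + L y0) = 0" | "ev d (f h) (c + L y0) < 0"
        by linarith
      then show ?thesis
      proof cases
        case 1
        then show ?thesis
          using pos[of "(h, True)"] sides_of_sgn[OF Cc y0(2) h] by (simp add: ev_g zr y0(1))
      next
        case 2
        then show ?thesis using zero[OF C h y0(2) _ zr] by simp
      next
        case 3
        then show ?thesis
          using pos[of "(h, False)"] sides_of_sgn[OF Cc y0(2) h] by (simp add: ev_g zr y0(1))
      qed
    qed
    moreover have "c + L z \<in> rspace d"
      using zr bij_betwE[OF L(2)] F_rspace[OF C] by blast
    ultimately show ?thesis
      using cell_eq_sign_cell[OF Cc y0(2)] by (simp add: sign_cell_def)
  qed
  have "(\<Sum>C\<in>X. vd j (polyh j g (sides d H f C))) \<le> (card H + 1) ^ (2 * j)"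
  proof (rule sum_vd_polyh_le[of "H \<times> (UNIV :: bool set)"])
    show "finite (H \<times> (UNIV :: bool set))" using finite_H by simp
    show "card (H \<times> (UNIV :: bool set)) \<le> 2 * card H" by (simp add: card_cartesian_product)
    show "finite X" by fact
    show "sides d H f C \<subseteq> H \<times> UNIV" for C by (auto simp: sides_def)
    show "core j (polyh j g (sides d H f C)) \<noteq> {}" if C: "C \<in> X" for C
    proof -
      obtain y0 where y0: "y0 \<in> rspace j" "c + L y0 \<in> C" using param[OF C] by blast
      have "0 < ev j (g l) y0 \<or> (\<forall>y\<in>rspace j. ev j (g l) y = 0)" if l: "l \<in> sides d H f C" for l
      proof (cases "ev d (f (fst l)) (c + L y0) = 0")
        case True
        have "fst l \<in> H" using l by (auto simp: sides_def)
        then have "ev j (g (fst l, snd l)) y = 0" if "y \<in> rspace j" for y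
          using zero[OF C _ y0(2) True that] by (simp only: ev_g[OF that]) simp
        then show ?thesis by simp
      next
        case False
        have "0 \<le> ev j (g l) y0"
          using l y0 by (simp add: sides_def g_def ev_pullback[OF L(1)])
        moreover have "ev j (g (fst l, snd l)) y0 \<noteq> 0"
          using False by (simp only: ev_g[OF y0(1)]) simp
        ultimately show ?thesis by simp
      qed
      then have "y0 \<in> core j (polyh j g (sides d H f C))"
        using fin y0(1) by (simp add: core_polyh)
      then show ?thesis by blast
    qed
    show "core j (polyh j g (sides d H f C)) \<inter> core j (polyh j g (sides d H f C')) = {}"
      if "C \<in> X" "C' \<in> X" "C \<noteq> C'" for C C'
      using core_in_cell[OF that(1)] core_in_cell[OF that(2)] cell_eq_if_common that X(1) by blast
  qed
  then show ?thesis using polyh_eq by simp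
qed

end

section \<open>The number of prisms\<close>

lemma binomial_le_Suc_power: "n choose i \<le> (n + 1) ^ i"
proof (cases "i \<le> n")
  case True
  then have "n choose i \<le> n ^ i" by (rule binomial_le_pow)
  also have "\<dots> \<le> (n + 1) ^ i" by (intro power_mono) auto
  finally show ?thesis .
qed (simp add: binomial_eq_0)

text \<open>With i = \<open>card G\<close> and N = \<open>card H + 1\<close> there are at most N^i
  sets, each of weight N^(2j), and i + j <= d gives i + 2j <= 2d. So each of the (d + 1)^2 classes
  (i, j) costs at most N^(2d).\<close>

lemma sum_subsets_le:
  fixes d :: nat
  assumes "finite H"
  defines "M \<equiv> {(G, j). G \<subseteq> H \<and> card G + j \<le> d}"
  shows "(\<Sum>m\<in>M. (card H + 1) ^ (2 * snd m)) \<le> (d + 1)\<^sup>2 * (card H + 1) ^ (2 * d)"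
proof -
  define N where "N = card H + 1"
  define idx where "idx m = (card (fst m), snd m)" for m :: "'a set \<times> nat"
  have "M \<subseteq> Pow H \<times> {..d}" by (auto simp: M_def)
  then have finM: "finite M" using assms(1) by (auto intro: finite_subset)
  have "(\<Sum>m\<in>M. N ^ (2 * snd m)) = (\<Sum>ij\<in>{..d} \<times> {..d}. \<Sum>m\<in>{m \<in> M. idx m = ij}. N ^ (2 * snd m))"
    using finM by (intro sum.group[symmetric]) (auto simp: M_def idx_def)
  also have "\<dots> \<le> (\<Sum>ij\<in>{..d} \<times> {..d}. N ^ (2 * d))"
  proof (rule sum_mono)
    fix ij :: "nat \<times> nat"
    obtain i j where ij: "ij = (i, j)" by force
    show "(\<Sum>m\<in>{m \<in> M. idx m = ij}. N ^ (2 * snd m)) \<le> N ^ (2 * d)"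
    proof (cases "i + j \<le> d")
      case False
      then have empty: "{m \<in> M. idx m = ij} = {}" by (auto simp: M_def idx_def ij)
      show ?thesis unfolding empty by simp
    next
      case True
      have "{m \<in> M. idx m = ij} \<subseteq> {G. G \<subseteq> H \<and> card G = i} \<times> {j}"
        by (auto simp: M_def idx_def ij)
      then have "card {m \<in> M. idx m = ij} \<le> card ({G. G \<subseteq> H \<and> card G = i} \<times> {j})"
        using assms(1) by (intro card_mono) auto
      also have "\<dots> = card H choose i"
        using n_subsets[OF assms(1), of i] by (simp add: card_cartesian_product)
      also have "\<dots> \<le> N ^ i" unfolding N_def by (rule binomial_le_Suc_power)
      finally have card_le: "card {m \<in> M. idx m = ij} \<le> N ^ i" .
      have "(\<Sum>m\<in>{m \<in> M. idx m = ij}. N ^ (2 * snd m)) = card {m \<in> M. idx m = ij} * N ^ (2 * j)"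
        by (simp add: idx_def ij)
      also have "\<dots> \<le> N ^ i * N ^ (2 * j)" using card_le by (rule mult_right_mono) simp
      also have "\<dots> = N ^ (i + 2 * j)" by (simp add: power_add)
      also have "\<dots> \<le> N ^ (2 * d)" using True by (intro power_increasing) (auto simp: N_def)
      finally show ?thesis .
    qed
  qed
  also have "\<dots> = (d + 1)\<^sup>2 * N ^ (2 * d)"
    by (simp add: card_cartesian_product power2_eq_square)
  finally show ?thesis by (simp add: N_def)
qed

context arrangement
begin

lemma VD_size_le:
  assumes frames: "\<And>C. C \<in> arr_cells d H \<Longrightarrow> adim C < d \<Longrightarrow>
    generic_frame (adim C) H (affine hull C) (fr (affine hull C))"
  shows "VD_size d H fr \<le> (d + 1)\<^sup>2 * (card H + 1) ^ (2 * d)"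
\<comment> \<open>With infinitely many cells the sum defining \<open>VD_size\<close> would be 0 by
  convention.\<close>
proof (cases "finite (arr_cells d H)")
  case False
  then show ?thesis by (simp add: VD_size_def)
next
  case True
  let ?cells = "arr_cells d H"
  define N where "N = card H + 1"
  define key where "key C = (affine hull C, adim C)" for C :: "vec set"
  define M where "M = {(G, j). G \<subseteq> H \<and> card G + j \<le> d}"
  define flat where "flat m = ({y \<in> rspace d. \<forall>h\<in>fst m. ev d (f h) y = 0}, snd m)" for m :: "vec set set \<times> nat"
  have "M \<subseteq> Pow H \<times> {..d}" by (auto simp: M_def)
  then have finM: "finite M" using finite_H by (auto intro: finite_subset)
  have keys: "key ` ?cells \<subseteq> flat ` M"
  proof
    fix \<kappa> assume "\<kappa> \<in> key ` ?cells"
    then obtain C where C: "C \<in> ?cells" "\<kappa> = key C" by blast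
    obtain G where G: "G \<subseteq> H" "affine hull C = {y \<in> rspace d. \<forall>h\<in>G. ev d (f h) y = 0}" "card G + adim C \<le> d"
      using affine_hull_cell_defining[OF C(1)] by blast
    then have "\<kappa> = flat (G, adim C)" "(G, adim C) \<in> M"
      using C(2) by (auto simp: key_def flat_def M_def)
    then show "\<kappa> \<in> flat ` M" by blast
  qed
  have fiber: "(\<Sum>C\<in>{C \<in> ?cells. key C = \<kappa>}. vd (adim C) (cell_coords d fr C)) \<le> N ^ (2 * snd \<kappa>)"
    if \<kappa>: "\<kappa> \<in> key ` ?cells" for \<kappa>
  proof -
    obtain C0 where C0: "C0 \<in> ?cells" "\<kappa> = key C0" using \<kappa> by blast
    define F where "F = affine hull C0"
    define j where "j = adim C0"
    define X where "X = {C \<in> ?cells. key C = \<kappa>}"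
    have X: "X \<subseteq> ?cells" "finite X" "\<And>C. C \<in> X \<Longrightarrow> affine hull C = F \<and> adim C = j"
      using True C0 by (auto simp: X_def key_def F_def j_def)
    have "j \<le> d"
      using affine_hull_cell_defining[OF C0(1)] by (auto simp: j_def)
    have "\<exists>L c. linear L \<and> bij_betw (\<lambda>y. c + L y) (rspace j) F
      \<and> (\<forall>C\<in>X. cell_coords d fr C = {y \<in> rspace j. c + L y \<in> closure C})"
    proof (cases "j = d")
      case True
      have "F = rspace d" using affine_hull_full_cell[OF C0(1)] True by (simp add: F_def j_def)
      moreover have "cell_coords d fr C = {y \<in> rspace d. y \<in> closure C}" if "C \<in> X" for C
      proof -
        have "C \<in> ?cells" "adim C = d" using X that True by blast+
        moreover have "closure C \<subseteq> rspace d"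
          using closure_cell[OF \<open>C \<in> ?cells\<close>] polyh_subset_rspace by metis
        ultimately show ?thesis by (auto simp: cell_coords_def)
      qed
      ultimately show ?thesis
        \<comment> \<open>Cells of dimension d keep the standard coordinates, which correspond to
          the frame with L = \<open>id\<close> and c = 0.\<close>
        using True by (intro exI[of _ id] exI[of _ 0]) (auto simp: linear_id bij_betw_def)
    next
      case False
      then have "generic_frame j H F (fr F)"
        using frames[OF C0(1)] \<open>j \<le> d\<close> by (simp add: F_def j_def)
      then obtain L c where L: "linear L" "fr F = (\<lambda>y. c + L y)" "bij_betw (fr F) (rspace j) F"
        unfolding generic_frame_def by blast
      then show ?thesis
        using X(3) False by (intro exI[of _ L] exI[of _ c]) (auto simp: cell_coords_def)
    qed
    then obtain L c where L: "linear L" "bij_betw (\<lambda>y. c + L y) (rspace j) F"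
      "\<And>C. C \<in> X \<Longrightarrow> cell_coords d fr C = {y \<in> rspace j. c + L y \<in> closure C}" by blast
    have "(\<Sum>C\<in>X. vd (adim C) (cell_coords d fr C)) = (\<Sum>C\<in>X. vd j {y \<in> rspace j. c + L y \<in> closure C})"
      using X(3) L(3) by (intro sum.cong) auto
    also have "\<dots> \<le> N ^ (2 * j)"
      unfolding N_def using X L by (intro sum_vd_cells_in_flat) auto
    finally show ?thesis by (simp add: X_def C0(2) key_def j_def)
  qed
  have "VD_size d H fr = (\<Sum>\<kappa>\<in>key ` ?cells. \<Sum>C\<in>{C \<in> ?cells. key C = \<kappa>}. vd (adim C) (cell_coords d fr C))"
    unfolding VD_size_def using True by (rule sum.image_gen)
  also have "\<dots> \<le> (\<Sum>\<kappa>\<in>key ` ?cells. N ^ (2 * snd \<kappa>))"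
    using fiber by (rule sum_mono)
  also have "\<dots> \<le> (\<Sum>\<kappa>\<in>flat ` M. N ^ (2 * snd \<kappa>))"
    using keys finM by (intro sum_mono2) auto
  \<comment> \<open>Different sets G may cut out the same flat; summing over M merely
    overcounts.\<close>
  also have "\<dots> \<le> (\<Sum>m\<in>M. N ^ (2 * snd m))"
    using sum_image_le[of M "\<lambda>\<kappa>. N ^ (2 * snd \<kappa>)" flat] finM by (simp add: o_def flat_def)
  also have "\<dots> \<le> (d + 1)\<^sup>2 * N ^ (2 * d)"
    unfolding N_def M_def using finite_H by (rule sum_subsets_le)
  finally show ?thesis by (simp add: N_def)
qed

end

lemma hyperplane_functional:
  assumes "hyperplane_in d h"
  shows "\<exists>w. h = {x \<in> rspace d. ev d w x = 0}"
proof -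
  obtain a b where "h = {x \<in> rspace d. (\<Sum>i<d. a i * x i) = b}"
    using assms by (auto simp: hyperplane_in_def)
  then have "h = {x \<in> rspace d. ev d (a, - b) x = 0}"
    by (auto simp: ev_def lin_def)
  then show ?thesis by blast
qed

section \<open>Numerical estimates behind the constant\<close>

lemma Suc_power_le:
  assumes "1 \<le> d" "2 * d \<le> n"
  shows "(real n + 1) ^ (2 * d) \<le> 3 * real n ^ (2 * d)"
proof -
  have n: "real n > 0" using assms by simp
  have "(1 + 1 / real n) ^ (2 * d) \<le> exp (1 / real n) ^ (2 * d)"
    using n exp_ge_add_one_self[of "1 / real n"] by (intro power_mono) auto
  also have "\<dots> = exp (real (2 * d) * (1 / real n))"
    by (rule exp_of_nat_mult[symmetric])
  also have "\<dots> \<le> exp 1"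
    using assms n by (simp add: field_simps)
  also have "\<dots> \<le> 3" by (rule exp_le)
  finally have "(1 + 1 / real n) ^ (2 * d) * real n ^ (2 * d) \<le> 3 * real n ^ (2 * d)"
    by (rule mult_right_mono) simp
  moreover have "(1 + 1 / real n) * real n = real n + 1" using n by (simp add: field_simps)
  ultimately show ?thesis by (simp flip: power_mult_distrib)
qed

text \<open>Bernoulli for 5/4, whose sixth power is below 4.\<close>

lemma power6_le_four_power: "real d ^ 6 \<le> 4096 * 4 ^ d"
proof -
  have "real d / 4 \<le> (1 + 1/4) ^ d"
    using Bernoulli_inequality[of "1/4 :: real" d] by simp
  then have "(real d / 4) ^ 6 \<le> ((1 + 1/4) ^ d) ^ 6"
    by (intro power_mono) auto
  also have "\<dots> = ((1 + 1/4) ^ 6) ^ d" by (simp only: power_mult[symmetric] mult.commute)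
  also have "\<dots> \<le> 4 ^ d" by (intro power_mono) (auto simp: power_divide)
  finally show ?thesis by (simp add: power_divide)
qed

theorem mainTheorem14:
  shows "\<exists>c::real. \<forall>d n::nat. \<forall>H::vec set set. \<forall>fr::vec set \<Rightarrow> vec \<Rightarrow> vec.
    d \<ge> 1 \<and> n \<ge> 2 * d \<and> finite H \<and> card H = n \<and> (\<forall>h\<in>H. hyperplane_in d h) \<and>
    generic_arrangement d H \<and>
    (\<forall>C\<in>arr_cells d H. adim C < d \<longrightarrow>
        generic_frame (adim C) H (affine hull C) (fr (affine hull C)))
    \<longrightarrow> real (VD_size d H fr) \<le> c * 4 ^ d / real d powr (7/2) * real n ^ (2 * d)"
\<comment> \<open>49152 = 12 * 4096. The factor 12 is 4 * 3, from (d + 1)^2 <= 4 d^2 and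
  \<open>Suc_power_le\<close>. Rounding 7/2 up to 4 leaves d^2 * d^4 = d^6 to be absorbed, and
  \<open>power6_le_four_power\<close> does this at the cost 4096 = 4^6.\<close>
proof (intro exI[of _ 49152] allI impI, elim conjE)
  fix d n :: nat and H :: "vec set set" and fr :: "vec set \<Rightarrow> vec \<Rightarrow> vec"
  assume d: "d \<ge> 1" and n: "n \<ge> 2 * d" and H: "finite H" "card H = n" "\<forall>h\<in>H. hyperplane_in d h"
    and fr: "\<forall>C\<in>arr_cells d H. adim C < d \<longrightarrow>
        generic_frame (adim C) H (affine hull C) (fr (affine hull C))"
  obtain f where f: "\<And>h. h \<in> H \<Longrightarrow> h = {x \<in> rspace d. ev d (f h) x = 0}"
    using H(3) hyperplane_functional by metis
  interpret arrangement d H f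
    using H(1) f by unfold_locales
  have "real (VD_size d H fr) \<le> real ((d + 1)\<^sup>2 * (n + 1) ^ (2 * d))"
    unfolding of_nat_le_iff using VD_size_le[of fr] fr H(2) by blast
  also have "\<dots> = (real d + 1)\<^sup>2 * (real n + 1) ^ (2 * d)"
    by (simp add: add.commute)
  also have "\<dots> \<le> (2 * real d)\<^sup>2 * (3 * real n ^ (2 * d))"
    using d Suc_power_le[OF d n] by (intro mult_mono power_mono) auto
  also have "\<dots> = 12 * real d ^ 2 * real n ^ (2 * d)" by (simp add: power2_eq_square)
  also have "\<dots> \<le> 49152 * 4 ^ d / real d powr (7/2) * real n ^ (2 * d)"
  proof (rule mult_right_mono)
    have "real d powr (7/2) \<le> real d powr 4" using d by (intro powr_mono) auto
    also have "\<dots> = real d ^ 4" using d by (simp add: powr_numeral)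
    finally have "12 * real d ^ 2 * real d powr (7/2) \<le> 12 * real d ^ 2 * real d ^ 4"
      by (intro mult_left_mono) auto
    also have "\<dots> = 12 * real d ^ 6" by (simp flip: power_add)
    also have "\<dots> \<le> 49152 * 4 ^ d" using power6_le_four_power[of d] by simp
    finally show "12 * real d ^ 2 \<le> 49152 * 4 ^ d / real d powr (7/2)"
      using d by (simp add: pos_le_divide_eq)
  qed simp
  finally show "real (VD_size d H fr) \<le> 49152 * 4 ^ d / real d powr (7/2) * real n ^ (2 * d)" .
qed

end
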